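(* Let $\mathcal{I}$ be any one of $\mathcal{P}$, $\mathcal{P}_\infty$, $\mathcal{B}$. The isometry class $\{\mu\in\mathcal{I}: X_\mu$ has the DLD2P$\}$ is $G_\delta$-complete in $\mathcal{I}$.
   Context: Coding: $V$ is the set of finitely supported rational sequences; $\mathcal{P}\subset\mathbb{R}^V$ the seminorms on $V$ with pointwise convergence topology; for $\mu\in\mathcal{P}$, $\bar\mu$ is its seminorm extension to $c_{00}$ and $X_\mu$ the completion of $c_{00}/\{\bar\mu=0\}$; $\mathcal{P}_\infty=\{\mu:\dim X_\mu=\infty\}$, $\mathcal{B}=\{\mu\in\mathcal{P}_\infty:\bar\mu$ a norm on $c_{00}\}$, subspace topologies. DLD2P: for every $\varepsilon>0$, every slice $S=\{y\in B_X:f(y)>1-\alpha\}$ ($f\in S_{X^*}$, $\alpha>0$) and every $x\in S\cap S_X$ there is $y\in S$ with $\|x-y\|>2-\varepsilon$. A set $A$ in a Polish space $Z$ is $G_\delta$-complete if it is $G_\delta$ and every $G_\delta$ subset of every zero-dimensional Polish space is a continuous preimage of $A$. *)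

theory Defs
  imports "HOL-Analysis.Analysis"
begin

definition Vset :: "(nat \<Rightarrow> rat) set" where
  "Vset = {x. finite {i. x i \<noteq> 0}}"

definition c00 :: "(nat \<Rightarrow> real) set" where
  "c00 = {x. finite {i. x i \<noteq> 0}}"

definition RV :: "((nat \<Rightarrow> rat) \<Rightarrow> real) topology" where
  "RV = product_topology (\<lambda>_. euclideanreal) Vset"

definition seminorm_V :: "((nat \<Rightarrow> rat) \<Rightarrow> real) \<Rightarrow> bool" where
  "seminorm_V \<mu> \<longleftrightarrow>
     (\<forall>x\<in>Vset. \<forall>y\<in>Vset. \<mu> (\<lambda>i. x i + y i) \<le> \<mu> x + \<mu> y) \<and>
     (\<forall>q::rat. \<forall>x\<in>Vset. \<mu> (\<lambda>i. q * x i) = real_of_rat \<bar>q\<bar> * \<mu> x)"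

definition Pcal :: "((nat \<Rightarrow> rat) \<Rightarrow> real) set" where
  "Pcal = {\<mu> \<in> topspace RV. seminorm_V \<mu>}"

definition seminorm_c00 :: "((nat \<Rightarrow> real) \<Rightarrow> real) \<Rightarrow> bool" where
  "seminorm_c00 g \<longleftrightarrow>
     (\<forall>x\<in>c00. \<forall>y\<in>c00. g (\<lambda>i. x i + y i) \<le> g x + g y) \<and>
     (\<forall>a::real. \<forall>x\<in>c00. g (\<lambda>i. a * x i) = \<bar>a\<bar> * g x) \<and>
     (\<forall>x. x \<notin> c00 \<longrightarrow> g x = 0)"

definition mu_bar :: "((nat \<Rightarrow> rat) \<Rightarrow> real) \<Rightarrow> (nat \<Rightarrow> real) \<Rightarrow> real" where
  "mu_bar \<mu> = (THE g. seminorm_c00 g \<and> (\<forall>v\<in>Vset. g (\<lambda>i. real_of_rat (v i)) = \<mu> v))"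

subsection \<open>The completion X_mu of c00 / {mu_bar = 0}\<close>

text \<open>Elements of X_mu are equivalence classes of mu_bar-Cauchy sequences in c00.\<close>
definition cauchy_mu :: "((nat \<Rightarrow> rat) \<Rightarrow> real) \<Rightarrow> (nat \<Rightarrow> nat \<Rightarrow> real) \<Rightarrow> bool" where
  "cauchy_mu \<mu> s \<longleftrightarrow> (\<forall>n. s n \<in> c00) \<and>
     (\<forall>e>0. \<exists>N. \<forall>a\<ge>N. \<forall>b\<ge>N. mu_bar \<mu> (\<lambda>i. s a i - s b i) < e)"

definition equiv_mu :: "((nat \<Rightarrow> rat) \<Rightarrow> real) \<Rightarrow> (nat \<Rightarrow> nat \<Rightarrow> real) \<Rightarrow> (nat \<Rightarrow> nat \<Rightarrow> real) \<Rightarrow> bool" where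
  "equiv_mu \<mu> s t \<longleftrightarrow> (\<lambda>n. mu_bar \<mu> (\<lambda>i. s n i - t n i)) \<longlonglongrightarrow> 0"

definition cls :: "((nat \<Rightarrow> rat) \<Rightarrow> real) \<Rightarrow> (nat \<Rightarrow> nat \<Rightarrow> real) \<Rightarrow> (nat \<Rightarrow> nat \<Rightarrow> real) set" where
  "cls \<mu> s = {t. cauchy_mu \<mu> t \<and> equiv_mu \<mu> s t}"

definition Xcar :: "((nat \<Rightarrow> rat) \<Rightarrow> real) \<Rightarrow> (nat \<Rightarrow> nat \<Rightarrow> real) set set" where
  "Xcar \<mu> = cls \<mu> ` {s. cauchy_mu \<mu> s}"

definition rep :: "(nat \<Rightarrow> nat \<Rightarrow> real) set \<Rightarrow> nat \<Rightarrow> nat \<Rightarrow> real" where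
  "rep c = (SOME s. s \<in> c)"

definition Xnorm :: "((nat \<Rightarrow> rat) \<Rightarrow> real) \<Rightarrow> (nat \<Rightarrow> nat \<Rightarrow> real) set \<Rightarrow> real" where
  "Xnorm \<mu> c = lim (\<lambda>n. mu_bar \<mu> (rep c n))"

definition Xadd :: "((nat \<Rightarrow> rat) \<Rightarrow> real) \<Rightarrow> (nat \<Rightarrow> nat \<Rightarrow> real) set \<Rightarrow> (nat \<Rightarrow> nat \<Rightarrow> real) set \<Rightarrow> (nat \<Rightarrow> nat \<Rightarrow> real) set" where
  "Xadd \<mu> c d = cls \<mu> (\<lambda>n i. rep c n i + rep d n i)"

definition Xscale :: "((nat \<Rightarrow> rat) \<Rightarrow> real) \<Rightarrow> real \<Rightarrow> (nat \<Rightarrow> nat \<Rightarrow> real) set \<Rightarrow> (nat \<Rightarrow> nat \<Rightarrow> real) set" where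
  "Xscale \<mu> a c = cls \<mu> (\<lambda>n i. a * rep c n i)"

definition Xzero :: "((nat \<Rightarrow> rat) \<Rightarrow> real) \<Rightarrow> (nat \<Rightarrow> nat \<Rightarrow> real) set" where
  "Xzero \<mu> = cls \<mu> (\<lambda>n i. 0)"

primrec lincomb :: "'x \<Rightarrow> ('x \<Rightarrow> 'x \<Rightarrow> 'x) \<Rightarrow> (real \<Rightarrow> 'x \<Rightarrow> 'x) \<Rightarrow> (nat \<Rightarrow> real) \<Rightarrow> (nat \<Rightarrow> 'x) \<Rightarrow> nat \<Rightarrow> 'x" where
  "lincomb z addop smul c x 0 = z"
| "lincomb z addop smul c x (Suc n) = addop (lincomb z addop smul c x n) (smul (c n) (x n))"

definition infinite_dim :: "'x set \<Rightarrow> 'x \<Rightarrow> ('x \<Rightarrow> 'x \<Rightarrow> 'x) \<Rightarrow> (real \<Rightarrow> 'x \<Rightarrow> 'x) \<Rightarrow> bool" where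
  "infinite_dim X z addop smul \<longleftrightarrow>
     (\<forall>n. \<exists>x. (\<forall>i<n. x i \<in> X) \<and>
        (\<forall>c. lincomb z addop smul c x n = z \<longrightarrow> (\<forall>i<n. c i = 0)))"

definition dual_sphere :: "'x set \<Rightarrow> ('x \<Rightarrow> 'x \<Rightarrow> 'x) \<Rightarrow> (real \<Rightarrow> 'x \<Rightarrow> 'x) \<Rightarrow> ('x \<Rightarrow> real) \<Rightarrow> ('x \<Rightarrow> real) \<Rightarrow> bool" where
  "dual_sphere X addop smul N f \<longleftrightarrow>
     (\<forall>x\<in>X. \<forall>y\<in>X. f (addop x y) = f x + f y) \<and>
     (\<forall>a. \<forall>x\<in>X. f (smul a x) = a * f x) \<and>
     (\<exists>C. \<forall>x\<in>X. \<bar>f x\<bar> \<le> C * N x) \<and>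
     Sup {\<bar>f x\<bar> | x. x \<in> X \<and> N x \<le> 1} = 1"

definition slice :: "'x set \<Rightarrow> ('x \<Rightarrow> real) \<Rightarrow> ('x \<Rightarrow> real) \<Rightarrow> real \<Rightarrow> 'x set" where
  "slice X N f \<alpha> = {y \<in> X. N y \<le> 1 \<and> f y > 1 - \<alpha>}"

definition DLD2P :: "'x set \<Rightarrow> ('x \<Rightarrow> 'x \<Rightarrow> 'x) \<Rightarrow> (real \<Rightarrow> 'x \<Rightarrow> 'x) \<Rightarrow> ('x \<Rightarrow> real) \<Rightarrow> bool" where
  "DLD2P X addop smul N \<longleftrightarrow>
     (\<forall>\<epsilon>>0. \<forall>f \<alpha>. dual_sphere X addop smul N f \<and> \<alpha> > 0 \<longrightarrow>
        (\<forall>x \<in> slice X N f \<alpha>. N x = 1 \<longrightarrow>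
           (\<exists>y \<in> slice X N f \<alpha>. N (addop x (smul (-1) y)) > 2 - \<epsilon>)))"

definition has_DLD2P :: "((nat \<Rightarrow> rat) \<Rightarrow> real) \<Rightarrow> bool" where
  "has_DLD2P \<mu> \<longleftrightarrow> DLD2P (Xcar \<mu>) (Xadd \<mu>) (Xscale \<mu>) (Xnorm \<mu>)"

definition Pinf :: "((nat \<Rightarrow> rat) \<Rightarrow> real) set" where
  "Pinf = {\<mu> \<in> Pcal. infinite_dim (Xcar \<mu>) (Xzero \<mu>) (Xadd \<mu>) (Xscale \<mu>)}"

definition Bcal :: "((nat \<Rightarrow> rat) \<Rightarrow> real) set" where
  "Bcal = {\<mu> \<in> Pinf. \<forall>x\<in>c00. mu_bar \<mu> x = 0 \<longrightarrow> x = (\<lambda>i. 0)}"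

definition Polish_space :: "'a topology \<Rightarrow> bool" where
  "Polish_space Y \<longleftrightarrow> completely_metrizable_space Y \<and> separable_space Y"

definition Gdelta_complete :: "'y itself \<Rightarrow> 'a topology \<Rightarrow> 'a set \<Rightarrow> bool" where
  "Gdelta_complete (_::'y itself) Z A \<longleftrightarrow>
     A \<subseteq> topspace Z \<and> gdelta_in Z A \<and>
     (\<forall>(Y::'y topology) B. Polish_space Y \<and> Y dim_le 0 \<and> gdelta_in Y B \<longrightarrow>
        (\<exists>f. continuous_map Y Z f \<and> {y \<in> topspace Y. f y \<in> A} = B))"

end

theory Submission
  imports Defs
begin

text \<open>
  By Hahn--Banach separation, \<open>X\<^sub>\<mu>\<close> has the DLD2P iff every unit vector \<open>x\<close> lies in the closed convex
  hull of \<open>{y \<in> B. \<parallel>x - y\<parallel> > 2 - \<epsilon>}\<close> for all \<open>\<epsilon> > 0\<close>. With all inequalities relaxed by \<open>\<epsilon>\<close> it is enough to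
  test \<open>x\<close>, the vectors \<open>y\<close> and the convex weights over the rationals, so the condition is a countable
  intersection of open conditions on \<open>\<mu>\<close>.

  For hardness, identify \<open>c00\<close> with the real polynomials and let \<open>\<mu>\<close> be the supremum norm over an infinite
  \<open>K \<subseteq> [0,1]\<close>, so that \<open>X\<^sub>\<mu>\<close> is the space of continuous functions on the closure of \<open>K\<close>. The DLD2P holds if
  \<open>K\<close> has no isolated points (perturb \<open>x\<close> by disjoint bumps near a point where it almost attains its norm) and
  fails if \<open>K\<close> has one. Given \<open>B = \<Inter>n. U n\<close> in a metric space, take for \<open>K\<close> at \<open>y\<close> a disjoint union of
  intervals whose \<open>n\<close>-th length is proportional to the distance from \<open>y\<close> to the complement of \<open>U n\<close>:
  this set has no isolated points iff \<open>y \<in> B\<close>, and the norms depend Lipschitz-continuously on \<open>y\<close>.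
\<close>

subsection \<open>The extension of a rational seminorm\<close>

text \<open>Separation needs functionals on the completion, while only values of
  \<open>\<mu>\<close> at rational vectors are open data. The bridge is a cone: if
  \<open>diametral_at\<close> fails, the pairs (sum of q_j (x - y_j), e times sum of q_j) have
  second component at most \<open>\<mu>\<close> of the first, and Hahn-Banach over the rationals
  yields one functional that drops by at least e from x to every diametral y. Leaving the weights
  unnormalised is what makes these pairs a cone. Real scalars and limits enter afterwards, by
  density.

  An isolated point a of K is an obstruction because evaluation at a separates: if x is nearly the
  indicator of a on K, a vector of almost the same norm and almost maximal distance to x can attain
  that distance only at a, and with the opposite sign there.

  In the reduction the left endpoints of the intervals do not depend on y, so an interval may shrink
  to a point but never disappears. Hence K is always infinite, the sup norm is a norm, and one map
  into \<open>Bcal\<close> serves all three classes. The intervals accumulate only at 0, which is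
  not in K, so a degenerate one is an isolated point.\<close>

definition unit_vec :: "nat \<Rightarrow> nat \<Rightarrow> 'a::zero_neq_one" where
  "unit_vec i j = (if j = i then 1 else 0)"

definition real_vec :: "(nat \<Rightarrow> rat) \<Rightarrow> nat \<Rightarrow> real" where
  "real_vec v i = real_of_rat (v i)"

lemma Vset_zero: "(\<lambda>i. 0) \<in> Vset"
  by (simp add: Vset_def)

lemma Vset_unit_vec: "unit_vec i \<in> Vset"
  by (simp add: Vset_def unit_vec_def)

lemma Vset_scale: "x \<in> Vset \<Longrightarrow> (\<lambda>i. q * x i) \<in> Vset"
  unfolding Vset_def by (auto elim: finite_subset[rotated])

lemma Vset_add: "x \<in> Vset \<Longrightarrow> y \<in> Vset \<Longrightarrow> (\<lambda>i. x i + y i) \<in> Vset"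
  unfolding Vset_def mem_Collect_eq
  by (rule finite_subset[of _ "{i. x i \<noteq> 0} \<union> {i. y i \<noteq> 0}"]) auto

lemma Vset_diff: "x \<in> Vset \<Longrightarrow> y \<in> Vset \<Longrightarrow> (\<lambda>i. x i - y i) \<in> Vset"
  unfolding Vset_def mem_Collect_eq
  by (rule finite_subset[of _ "{i. x i \<noteq> 0} \<union> {i. y i \<noteq> 0}"]) auto

lemma Vset_supported: "finite S \<Longrightarrow> (\<And>i. i \<notin> S \<Longrightarrow> v i = 0) \<Longrightarrow> v \<in> Vset"
  unfolding Vset_def mem_Collect_eq by (rule finite_subset[of _ S]) auto

lemma c00_zero: "(\<lambda>i. 0) \<in> c00"
  by (simp add: c00_def)

lemma c00_unit_vec: "unit_vec i \<in> c00"
  by (simp add: c00_def unit_vec_def)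

lemma c00_scale: "x \<in> c00 \<Longrightarrow> (\<lambda>i. q * x i) \<in> c00"
  unfolding c00_def by (auto elim: finite_subset[rotated])

lemma c00_add: "x \<in> c00 \<Longrightarrow> y \<in> c00 \<Longrightarrow> (\<lambda>i. x i + y i) \<in> c00"
  unfolding c00_def mem_Collect_eq
  by (rule finite_subset[of _ "{i. x i \<noteq> 0} \<union> {i. y i \<noteq> 0}"]) auto

lemma c00_diff: "x \<in> c00 \<Longrightarrow> y \<in> c00 \<Longrightarrow> (\<lambda>i. x i - y i) \<in> c00"
  unfolding c00_def mem_Collect_eq
  by (rule finite_subset[of _ "{i. x i \<noteq> 0} \<union> {i. y i \<noteq> 0}"]) auto

lemma c00_supported: "finite S \<Longrightarrow> (\<And>i. i \<notin> S \<Longrightarrow> v i = 0) \<Longrightarrow> v \<in> c00"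
  unfolding c00_def mem_Collect_eq by (rule finite_subset[of _ S]) auto

lemma c00_real_vec: "v \<in> Vset \<Longrightarrow> real_vec v \<in> c00"
  by (simp add: c00_def Vset_def real_vec_def)

lemma real_vec_add: "real_vec (\<lambda>i. x i + y i) = (\<lambda>i. real_vec x i + real_vec y i)"
  by (simp add: real_vec_def fun_eq_iff of_rat_add)

lemma real_vec_diff: "real_vec (\<lambda>i. x i - y i) = (\<lambda>i. real_vec x i - real_vec y i)"
  by (simp add: real_vec_def fun_eq_iff of_rat_diff)

lemma real_vec_scale: "real_vec (\<lambda>i. q * x i) = (\<lambda>i. real_of_rat q * real_vec x i)"
  by (simp add: real_vec_def fun_eq_iff of_rat_mult)

text \<open>Rounding down coordinatewise keeps zero coordinates zero, so all approximants of a
  vector live on its finite support.\<close>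

definition rat_approx :: "nat \<Rightarrow> (nat \<Rightarrow> real) \<Rightarrow> nat \<Rightarrow> rat" where
  "rat_approx n x i = of_int \<lfloor>real (Suc n) * x i\<rfloor> / of_nat (Suc n)"

lemma rat_approx_eq_0: "x i = 0 \<Longrightarrow> rat_approx n x i = 0"
  by (simp add: rat_approx_def)

lemma Vset_rat_approx: "x \<in> c00 \<Longrightarrow> rat_approx n x \<in> Vset"
  by (rule Vset_supported[of "{i. x i \<noteq> 0}"]) (auto simp: c00_def rat_approx_eq_0)

lemma rat_approx_tendsto: "(\<lambda>n. real_vec (rat_approx n x) i) \<longlonglongrightarrow> x i"
proof -
  have bound: "\<bar>real_vec (rat_approx n x) i - x i\<bar> \<le> inverse (real (Suc n))" for n
  proof -
    let ?z = "real (Suc n) * x i"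
    have eq: "real_vec (rat_approx n x) i = of_int \<lfloor>?z\<rfloor> / real (Suc n)"
      by (simp add: real_vec_def rat_approx_def of_rat_divide del: of_nat_Suc)
    have "real_vec (rat_approx n x) i - x i = (of_int \<lfloor>?z\<rfloor> - ?z) / real (Suc n)"
      unfolding eq by (simp add: diff_divide_distrib del: of_nat_Suc)
    moreover have "\<bar>of_int \<lfloor>?z\<rfloor> - ?z\<bar> \<le> 1"
      by linarith
    ultimately show ?thesis
      by (simp only: abs_divide) (simp add: inverse_eq_divide divide_right_mono del: of_nat_Suc)
  qed
  have "(\<lambda>n. real_vec (rat_approx n x) i - x i) \<longlonglongrightarrow> 0"
    by (rule Lim_null_comparison[OF _ LIMSEQ_inverse_real_of_nat])
      (use bound in \<open>auto simp del: of_nat_Suc\<close>)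
  then show ?thesis
    by (simp add: LIM_zero_iff)
qed

section \<open>Extending a rational seminorm by limits\<close>

locale rational_seminorm =
  fixes \<mu> :: "(nat \<Rightarrow> rat) \<Rightarrow> real"
  assumes seminorm: "seminorm_V \<mu>"
begin

lemma mu_add: "x \<in> Vset \<Longrightarrow> y \<in> Vset \<Longrightarrow> \<mu> (\<lambda>i. x i + y i) \<le> \<mu> x + \<mu> y"
  using seminorm by (simp add: seminorm_V_def)

lemma mu_scale: "x \<in> Vset \<Longrightarrow> \<mu> (\<lambda>i. q * x i) = \<bar>real_of_rat q\<bar> * \<mu> x"
  using seminorm by (simp add: seminorm_V_def)

lemma mu_zero: "\<mu> (\<lambda>i. 0) = 0"
  using mu_scale[OF Vset_zero, of 0] by simp

lemma mu_diff_commute: "x \<in> Vset \<Longrightarrow> y \<in> Vset \<Longrightarrow> \<mu> (\<lambda>i. x i - y i) = \<mu> (\<lambda>i. y i - x i)"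
  using mu_scale[OF Vset_diff[of x y], of "-1"] by simp

lemma mu_nonneg: "x \<in> Vset \<Longrightarrow> 0 \<le> \<mu> x"
  using mu_add[of x "\<lambda>i. -1 * x i"] mu_scale[of x "-1"] Vset_scale[of x "-1"] mu_zero by simp

lemma mu_le_diff: "x \<in> Vset \<Longrightarrow> y \<in> Vset \<Longrightarrow> \<mu> x \<le> \<mu> y + \<mu> (\<lambda>i. x i - y i)"
  using mu_add[of y "\<lambda>i. x i - y i"] Vset_diff[of x y] by simp

lemma mu_abs_diff_le:
  assumes "x \<in> Vset" "y \<in> Vset"
  shows "\<bar>\<mu> x - \<mu> y\<bar> \<le> \<mu> (\<lambda>i. x i - y i)"
  using mu_le_diff[of x y] mu_le_diff[of y x] mu_diff_commute[of x y] assms by linarith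

text \<open>One coordinate is split off at a time. On a fixed finite support the bound reduces
  convergence in \<open>\<mu>\<close> to convergence of coordinates.\<close>

lemma mu_le_sum:
  assumes "finite S" "\<And>i. i \<notin> S \<Longrightarrow> v i = 0"
  shows "\<mu> v \<le> (\<Sum>i\<in>S. \<bar>real_vec v i\<bar> * \<mu> (unit_vec i))"
  using assms
proof (induction S arbitrary: v rule: finite_induct)
  case empty
  then have "v = (\<lambda>i. 0)" by auto
  then show ?case by (simp add: mu_zero)
next
  case (insert j S)
  define w where "w = (\<lambda>i. if i = j then 0 else v i)"
  have "\<mu> v = \<mu> (\<lambda>i. w i + v j * unit_vec j i)"
    by (rule arg_cong[of _ _ \<mu>]) (auto simp: w_def unit_vec_def)
  also have "\<dots> \<le> \<mu> w + \<mu> (\<lambda>i. v j * unit_vec j i)"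
    using insert by (intro mu_add Vset_scale Vset_unit_vec Vset_supported[of S])
      (auto simp: w_def)
  also have "\<mu> w \<le> (\<Sum>i\<in>S. \<bar>real_vec w i\<bar> * \<mu> (unit_vec i))"
    using insert by (intro insert.IH) (auto simp: w_def)
  also have "\<dots> = (\<Sum>i\<in>S. \<bar>real_vec v i\<bar> * \<mu> (unit_vec i))"
    using insert by (intro sum.cong) (auto simp: w_def real_vec_def)
  finally show ?case
    using insert by (simp add: mu_scale Vset_unit_vec real_vec_def)
qed

lemma mu_diff_le_sum:
  assumes "finite S" "\<And>i. i \<notin> S \<Longrightarrow> u i = 0" "\<And>i. i \<notin> S \<Longrightarrow> v i = 0"
  shows "\<bar>\<mu> u - \<mu> v\<bar> \<le> (\<Sum>i\<in>S. \<bar>real_vec u i - real_vec v i\<bar> * \<mu> (unit_vec i))"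
proof -
  have "\<bar>\<mu> u - \<mu> v\<bar> \<le> \<mu> (\<lambda>i. u i - v i)"
    using assms by (intro mu_abs_diff_le Vset_supported[of S])
  also have "\<dots> \<le> (\<Sum>i\<in>S. \<bar>real_vec (\<lambda>i. u i - v i) i\<bar> * \<mu> (unit_vec i))"
    using assms by (intro mu_le_sum) auto
  finally show ?thesis by (simp add: real_vec_diff)
qed

text \<open>The candidate for \<open>mu_bar\<close>; the value 0 off \<open>c00\<close> is the one
  that \<open>seminorm_c00\<close> prescribes.\<close>

definition mu_lim :: "(nat \<Rightarrow> real) \<Rightarrow> real" where
  "mu_lim x = (if x \<in> c00 then lim (\<lambda>n. \<mu> (rat_approx n x)) else 0)"

text \<open>Weighted coordinate errors bound all differences of values, so any two approximations of
  x on a common finite support share their limit. This freedom is needed because sums and multiples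
  of approximants need not be the approximants of the sum or multiple.\<close>

lemma mu_lim_tendsto:
  assumes S: "finite S" "\<And>n i. i \<notin> S \<Longrightarrow> u n i = 0" "\<And>i. i \<notin> S \<Longrightarrow> x i = 0"
    and u: "\<And>i. i \<in> S \<Longrightarrow> (\<lambda>n. real_vec (u n) i) \<longlonglongrightarrow> x i"
  shows "(\<lambda>n. \<mu> (u n)) \<longlonglongrightarrow> mu_lim x"
proof -
  let ?r = "\<lambda>n. rat_approx n x"
  define b :: "(nat \<Rightarrow> nat \<Rightarrow> rat) \<Rightarrow> nat \<Rightarrow> real"
    where "b u n = (\<Sum>i\<in>S. \<bar>real_vec (u n) i - x i\<bar> * \<mu> (unit_vec i))" for u n
  have b0: "b u \<longlonglongrightarrow> 0" if "\<And>i. i \<in> S \<Longrightarrow> (\<lambda>n. real_vec (u n) i) \<longlonglongrightarrow> x i" for u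
    unfolding b_def
    by (rule tendsto_null_sum, rule tendsto_mult_left_zero, rule tendsto_rabs_zero)
      (use that in \<open>simp add: LIM_zero\<close>)
  have diff: "\<bar>\<mu> (u n) - \<mu> (v m)\<bar> \<le> b u n + b v m"
    if "\<And>n i. i \<notin> S \<Longrightarrow> u n i = 0" "\<And>n i. i \<notin> S \<Longrightarrow> v n i = 0" for u v n m
  proof -
    have "\<bar>\<mu> (u n) - \<mu> (v m)\<bar> \<le> (\<Sum>i\<in>S. \<bar>real_vec (u n) i - real_vec (v m) i\<bar> * \<mu> (unit_vec i))"
      using that S by (intro mu_diff_le_sum) auto
    also have "\<dots> \<le> (\<Sum>i\<in>S. (\<bar>real_vec (u n) i - x i\<bar> + \<bar>real_vec (v m) i - x i\<bar>) * \<mu> (unit_vec i))"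
      by (intro sum_mono mult_right_mono mu_nonneg Vset_unit_vec) linarith
    finally show ?thesis by (simp add: b_def sum.distrib distrib_right)
  qed
  have r: "\<And>n i. i \<notin> S \<Longrightarrow> ?r n i = 0"
    using S by (simp add: rat_approx_eq_0)
  have br: "b ?r \<longlonglongrightarrow> 0" by (rule b0) (rule rat_approx_tendsto)
  have "Cauchy (\<lambda>n. \<mu> (?r n))"
  proof (rule metric_CauchyI)
    fix e :: real assume "0 < e"
    then have "\<forall>\<^sub>F n in sequentially. b ?r n < e / 2"
      using br by (intro order_tendstoD) auto
    then obtain N where N: "\<And>n. n \<ge> N \<Longrightarrow> b ?r n < e / 2"
      by (auto simp: eventually_sequentially)
    have "dist (\<mu> (?r m)) (\<mu> (?r n)) < e" if "m \<ge> N" "n \<ge> N" for m n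
    proof -
      have "dist (\<mu> (?r m)) (\<mu> (?r n)) \<le> b ?r m + b ?r n"
        unfolding dist_real_def using r by (intro diff)
      then show ?thesis using N[OF that(1)] N[OF that(2)] by linarith
    qed
    then show "\<exists>N. \<forall>m\<ge>N. \<forall>n\<ge>N. dist (\<mu> (?r m)) (\<mu> (?r n)) < e" by blast
  qed
  then have "(\<lambda>n. \<mu> (?r n)) \<longlonglongrightarrow> lim (\<lambda>n. \<mu> (?r n))"
    by (simp add: Cauchy_convergent_iff convergent_LIMSEQ_iff)
  then have 1: "(\<lambda>n. \<mu> (?r n)) \<longlonglongrightarrow> mu_lim x"
    using c00_supported[OF S(1,3)] by (simp add: mu_lim_def)
  have "(\<lambda>n. \<mu> (u n) - \<mu> (?r n)) \<longlonglongrightarrow> 0"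
  proof (rule Lim_null_comparison)
    show "(\<lambda>n. b u n + b ?r n) \<longlonglongrightarrow> 0"
      using tendsto_add[OF b0[OF u] br] by simp
    show "\<forall>\<^sub>F n in sequentially. norm (\<mu> (u n) - \<mu> (?r n)) \<le> b u n + b ?r n"
      using diff[of u ?r] S r by simp
  qed
  from tendsto_add[OF this 1] show ?thesis by simp
qed

lemma rat_approx_mu_lim: "x \<in> c00 \<Longrightarrow> (\<lambda>n. \<mu> (rat_approx n x)) \<longlonglongrightarrow> mu_lim x"
  by (rule mu_lim_tendsto[of "{i. x i \<noteq> 0}"])
    (auto simp: c00_def rat_approx_eq_0 rat_approx_tendsto)

lemma seminorm_c00_mu_lim: "seminorm_c00 mu_lim"
  unfolding seminorm_c00_def
proof (intro conjI ballI allI impI)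
  fix x y assume x: "x \<in> c00" and y: "y \<in> c00"
  have "(\<lambda>n. \<mu> (\<lambda>i. rat_approx n x i + rat_approx n y i)) \<longlonglongrightarrow> mu_lim (\<lambda>i. x i + y i)"
    by (rule mu_lim_tendsto[of "{i. x i \<noteq> 0} \<union> {i. y i \<noteq> 0}"])
      (use x y in \<open>auto simp: c00_def rat_approx_eq_0 real_vec_add intro!: tendsto_add rat_approx_tendsto\<close>)
  moreover have "(\<lambda>n. \<mu> (rat_approx n x) + \<mu> (rat_approx n y)) \<longlonglongrightarrow> mu_lim x + mu_lim y"
    by (intro tendsto_add rat_approx_mu_lim x y)
  ultimately show "mu_lim (\<lambda>i. x i + y i) \<le> mu_lim x + mu_lim y"
    by (rule LIMSEQ_le) (use x y in \<open>auto intro!: mu_add Vset_rat_approx\<close>)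
next
  fix a :: real and x assume x: "x \<in> c00"
  \<comment> \<open>The scalar is approximated through coordinate 0 of a constant sequence;
    coordinatewise convergence also holds outside \<open>c00\<close>.\<close>
  define q where "q n = rat_approx n (\<lambda>_. a) 0" for n
  have q: "(\<lambda>n. real_of_rat (q n)) \<longlonglongrightarrow> a"
    using rat_approx_tendsto[of "\<lambda>_. a" 0] by (simp add: q_def real_vec_def)
  have "(\<lambda>n. \<mu> (\<lambda>i. q n * rat_approx n x i)) \<longlonglongrightarrow> mu_lim (\<lambda>i. a * x i)"
    by (rule mu_lim_tendsto[of "{i. x i \<noteq> 0}"])
      (use x in \<open>auto simp: c00_def rat_approx_eq_0 real_vec_scale intro!: tendsto_mult rat_approx_tendsto q\<close>)
  moreover have "(\<lambda>n. \<bar>real_of_rat (q n)\<bar> * \<mu> (rat_approx n x)) \<longlonglongrightarrow> \<bar>a\<bar> * mu_lim x"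
    by (intro tendsto_mult tendsto_rabs q rat_approx_mu_lim x)
  ultimately show "mu_lim (\<lambda>i. a * x i) = \<bar>a\<bar> * mu_lim x"
    using x by (simp add: mu_scale Vset_rat_approx LIMSEQ_unique)
qed (simp add: mu_lim_def)

lemma mu_lim_real_vec:
  assumes "v \<in> Vset"
  shows "mu_lim (real_vec v) = \<mu> v"
proof -
  have "(\<lambda>n. \<mu> v) \<longlonglongrightarrow> mu_lim (real_vec v)"
    by (rule mu_lim_tendsto[of "{i. v i \<noteq> 0}"]) (use assms in \<open>auto simp: Vset_def real_vec_def\<close>)
  then show ?thesis by (simp add: LIMSEQ_const_iff)
qed

end

section \<open>Real seminorms on c00: density of rational vectors and uniqueness\<close>

lemma seminorm_c00_add: "seminorm_c00 g \<Longrightarrow> x \<in> c00 \<Longrightarrow> y \<in> c00 \<Longrightarrow> g (\<lambda>i. x i + y i) \<le> g x + g y"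
  by (simp add: seminorm_c00_def)

lemma seminorm_c00_scale: "seminorm_c00 g \<Longrightarrow> x \<in> c00 \<Longrightarrow> g (\<lambda>i. a * x i) = \<bar>a\<bar> * g x"
  by (simp add: seminorm_c00_def)

lemma seminorm_c00_zero: "seminorm_c00 g \<Longrightarrow> g (\<lambda>i. 0) = 0"
  using seminorm_c00_scale[OF _ c00_zero, of g 0] by simp

lemma seminorm_c00_diff_commute:
  "seminorm_c00 g \<Longrightarrow> x \<in> c00 \<Longrightarrow> y \<in> c00 \<Longrightarrow> g (\<lambda>i. x i - y i) = g (\<lambda>i. y i - x i)"
  using seminorm_c00_scale[OF _ c00_diff[of x y], of g "-1"] by simp

lemma seminorm_c00_nonneg: "seminorm_c00 g \<Longrightarrow> 0 \<le> g x"
  using seminorm_c00_add[of g x "\<lambda>i. -1 * x i"] seminorm_c00_scale[of g x "-1"]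
    c00_scale[of x "-1"] seminorm_c00_zero[of g]
  by (cases "x \<in> c00") (auto simp: seminorm_c00_def)

lemma seminorm_c00_le_diff:
  "seminorm_c00 g \<Longrightarrow> x \<in> c00 \<Longrightarrow> y \<in> c00 \<Longrightarrow> g x \<le> g y + g (\<lambda>i. x i - y i)"
  using seminorm_c00_add[of g y "\<lambda>i. x i - y i"] c00_diff[of x y] by simp

lemma seminorm_c00_abs_diff_le:
  "seminorm_c00 g \<Longrightarrow> x \<in> c00 \<Longrightarrow> y \<in> c00 \<Longrightarrow> \<bar>g x - g y\<bar> \<le> g (\<lambda>i. x i - y i)"
  using seminorm_c00_le_diff[of g x y] seminorm_c00_le_diff[of g y x]
    seminorm_c00_diff_commute[of g x y] by linarith

lemma seminorm_c00_le_sum: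
  assumes "seminorm_c00 g" "finite S" "\<And>i. i \<notin> S \<Longrightarrow> v i = 0"
  shows "g v \<le> (\<Sum>i\<in>S. \<bar>v i\<bar> * g (unit_vec i))"
  using assms(2,3)
proof (induction S arbitrary: v rule: finite_induct)
  case empty
  then have "v = (\<lambda>i. 0)" by auto
  then show ?case by (simp add: seminorm_c00_zero[OF assms(1)])
next
  case (insert j S)
  define w where "w = (\<lambda>i. if i = j then 0 else v i)"
  have "g v = g (\<lambda>i. w i + v j * unit_vec j i)"
    by (rule arg_cong[of _ _ g]) (auto simp: w_def unit_vec_def)
  also have "\<dots> \<le> g w + g (\<lambda>i. v j * unit_vec j i)"
    using insert by (intro seminorm_c00_add assms(1) c00_scale c00_unit_vec c00_supported[of S])
      (auto simp: w_def)
  also have "g w \<le> (\<Sum>i\<in>S. \<bar>w i\<bar> * g (unit_vec i))"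
    using insert by (intro insert.IH) (auto simp: w_def)
  also have "\<dots> = (\<Sum>i\<in>S. \<bar>v i\<bar> * g (unit_vec i))"
    using insert by (intro sum.cong) (auto simp: w_def)
  finally show ?case
    using insert by (simp add: seminorm_c00_scale[OF assms(1)] c00_unit_vec)
qed

lemma seminorm_c00_rat_approx:
  assumes g: "seminorm_c00 g" and x: "x \<in> c00"
  shows "(\<lambda>n. g (\<lambda>i. x i - real_vec (rat_approx n x) i)) \<longlonglongrightarrow> 0"
proof (rule Lim_null_comparison)
  let ?S = "{i. x i \<noteq> 0}"
  show "\<forall>\<^sub>F n in sequentially. norm (g (\<lambda>i. x i - real_vec (rat_approx n x) i))
      \<le> (\<Sum>i\<in>?S. \<bar>x i - real_vec (rat_approx n x) i\<bar> * g (unit_vec i))"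
    using x by (intro always_eventually allI)
      (auto simp: seminorm_c00_nonneg[OF g] c00_def rat_approx_eq_0 real_vec_def
        intro!: seminorm_c00_le_sum[OF g])
  show "(\<lambda>n. \<Sum>i\<in>?S. \<bar>x i - real_vec (rat_approx n x) i\<bar> * g (unit_vec i)) \<longlonglongrightarrow> 0"
    by (rule tendsto_null_sum, rule tendsto_mult_left_zero, rule tendsto_rabs_zero)
      (rule tendsto_eq_intros rat_approx_tendsto refl | simp)+
qed

lemma seminorm_c00_rat_dense:
  assumes "seminorm_c00 g" "x \<in> c00" "0 < e"
  obtains v where "v \<in> Vset" "g (\<lambda>i. x i - real_vec v i) < e"
proof -
  have "\<forall>\<^sub>F n in sequentially. g (\<lambda>i. x i - real_vec (rat_approx n x) i) < e"
    using seminorm_c00_rat_approx[OF assms(1,2)] assms(3) by (rule order_tendstoD)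
  then obtain n where "g (\<lambda>i. x i - real_vec (rat_approx n x) i) < e"
    by (auto simp: eventually_sequentially)
  then show ?thesis using that Vset_rat_approx assms by blast
qed

lemma seminorm_c00_tendsto_rat_approx:
  assumes g: "seminorm_c00 g" and x: "x \<in> c00"
  shows "(\<lambda>n. g (real_vec (rat_approx n x))) \<longlonglongrightarrow> g x"
proof -
  have "(\<lambda>n. g x - g (real_vec (rat_approx n x))) \<longlonglongrightarrow> 0"
    by (rule Lim_null_comparison[OF _ seminorm_c00_rat_approx[OF g x]])
      (auto intro!: always_eventually seminorm_c00_abs_diff_le g x c00_real_vec Vset_rat_approx)
  from tendsto_diff[OF tendsto_const[of "g x"] this] show ?thesis by simp
qed

text \<open>Both seminorms are limits of their values at the same rational approximants, and both
  are 0 off \<open>c00\<close>.\<close>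

lemma seminorm_c00_unique:
  assumes g: "seminorm_c00 g" and h: "seminorm_c00 h"
    and eq: "\<And>v. v \<in> Vset \<Longrightarrow> g (real_vec v) = h (real_vec v)"
  shows "g = h"
proof
  fix x
  show "g x = h x"
  proof (cases "x \<in> c00")
    case True
    show ?thesis
      using seminorm_c00_tendsto_rat_approx[OF g True] seminorm_c00_tendsto_rat_approx[OF h True]
      by (simp add: eq Vset_rat_approx True LIMSEQ_unique)
  qed (use g h in \<open>simp add: seminorm_c00_def\<close>)
qed

lemma mu_bar_eqI:
  assumes "seminorm_c00 g" "\<And>v. v \<in> Vset \<Longrightarrow> g (real_vec v) = \<mu> v"
  shows "mu_bar \<mu> = g"
  unfolding mu_bar_def
proof (rule the_equality)
  show "seminorm_c00 g \<and> (\<forall>v\<in>Vset. g (\<lambda>i. real_of_rat (v i)) = \<mu> v)"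
    using assms by (simp add: real_vec_def[abs_def])
  show "h = g" if "seminorm_c00 h \<and> (\<forall>v\<in>Vset. h (\<lambda>i. real_of_rat (v i)) = \<mu> v)" for h
    using that assms by (intro seminorm_c00_unique) (auto simp: real_vec_def[abs_def])
qed

context rational_seminorm
begin

lemma mu_bar_eq_mu_lim: "mu_bar \<mu> = mu_lim"
  by (rule mu_bar_eqI) (auto simp: seminorm_c00_mu_lim mu_lim_real_vec)

lemma seminorm_c00_mu_bar: "seminorm_c00 (mu_bar \<mu>)"
  by (simp add: mu_bar_eq_mu_lim seminorm_c00_mu_lim)

lemma mu_bar_real_vec: "v \<in> Vset \<Longrightarrow> mu_bar \<mu> (real_vec v) = \<mu> v"
  by (simp add: mu_bar_eq_mu_lim mu_lim_real_vec)

end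

subsection \<open>The completion\<close>

text \<open>Written so that it coincides literally with the distance expression inside
  \<open>DLD2P\<close>.\<close>

definition Xdist :: "((nat \<Rightarrow> rat) \<Rightarrow> real) \<Rightarrow> (nat \<Rightarrow> nat \<Rightarrow> real) set \<Rightarrow> (nat \<Rightarrow> nat \<Rightarrow> real) set \<Rightarrow> real" where
  "Xdist \<mu> c d = Xnorm \<mu> (Xadd \<mu> c (Xscale \<mu> (-1) d))"

definition Xembed :: "((nat \<Rightarrow> rat) \<Rightarrow> real) \<Rightarrow> (nat \<Rightarrow> real) \<Rightarrow> (nat \<Rightarrow> nat \<Rightarrow> real) set" where
  "Xembed \<mu> x = cls \<mu> (\<lambda>_. x)"

context rational_seminorm
begin

abbreviation g :: "(nat \<Rightarrow> real) \<Rightarrow> real" where "g \<equiv> mu_bar \<mu>"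

lemmas g_add = seminorm_c00_add[OF seminorm_c00_mu_bar]
  and g_scale = seminorm_c00_scale[OF seminorm_c00_mu_bar]
  and g_zero = seminorm_c00_zero[OF seminorm_c00_mu_bar]
  and g_nonneg = seminorm_c00_nonneg[OF seminorm_c00_mu_bar]
  and g_diff_commute = seminorm_c00_diff_commute[OF seminorm_c00_mu_bar]
  and g_abs_diff_le = seminorm_c00_abs_diff_le[OF seminorm_c00_mu_bar]

lemma g_triangle:
  assumes "x \<in> c00" "y \<in> c00" "z \<in> c00"
  shows "g (\<lambda>i. x i - z i) \<le> g (\<lambda>i. x i - y i) + g (\<lambda>i. y i - z i)"
  using g_add[of "\<lambda>i. x i - y i" "\<lambda>i. y i - z i"] assms by (simp add: c00_diff)

lemma g_diff_add_le:
  assumes "x \<in> c00" "y \<in> c00" "x' \<in> c00" "y' \<in> c00"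
  shows "g (\<lambda>i. x i + y i - (x' i + y' i)) \<le> g (\<lambda>i. x i - x' i) + g (\<lambda>i. y i - y' i)"
  using g_add[of "\<lambda>i. x i - x' i" "\<lambda>i. y i - y' i"] assms
  by (simp add: c00_diff algebra_simps)

lemma cauchy_mu_c00: "cauchy_mu \<mu> s \<Longrightarrow> s n \<in> c00"
  by (simp add: cauchy_mu_def)

lemma cauchy_mu_const: "x \<in> c00 \<Longrightarrow> cauchy_mu \<mu> (\<lambda>_. x)"
  by (simp add: cauchy_mu_def g_zero)

lemma cauchy_mu_add:
  assumes s: "cauchy_mu \<mu> s" and t: "cauchy_mu \<mu> t"
  shows "cauchy_mu \<mu> (\<lambda>n i. s n i + t n i)"
  unfolding cauchy_mu_def
proof (intro conjI allI impI)
  fix e :: real assume e: "0 < e"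
  obtain M where M: "\<And>a b. a \<ge> M \<Longrightarrow> b \<ge> M \<Longrightarrow> g (\<lambda>i. s a i - s b i) < e / 2"
    using s half_gt_zero[OF e] unfolding cauchy_mu_def by metis
  obtain N where N: "\<And>a b. a \<ge> N \<Longrightarrow> b \<ge> N \<Longrightarrow> g (\<lambda>i. t a i - t b i) < e / 2"
    using t half_gt_zero[OF e] unfolding cauchy_mu_def by metis
  show "\<exists>N. \<forall>a\<ge>N. \<forall>b\<ge>N. g (\<lambda>i. s a i + t a i - (s b i + t b i)) < e"
  proof (intro exI allI impI)
    fix a b assume "max M N \<le> a" "max M N \<le> b"
    then show "g (\<lambda>i. s a i + t a i - (s b i + t b i)) < e"
      using M[of a b] N[of a b] g_diff_add_le[of "s a" "t a" "s b" "t b"] s t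
      by (simp add: cauchy_mu_c00)
  qed
qed (use s t in \<open>simp add: cauchy_mu_c00 c00_add\<close>)

lemma cauchy_mu_scale:
  assumes s: "cauchy_mu \<mu> s"
  shows "cauchy_mu \<mu> (\<lambda>n i. q * s n i)"
  unfolding cauchy_mu_def
proof (intro conjI allI impI)
  fix e :: real assume e: "0 < e"
  \<comment> \<open>Adding 1 keeps the denominator positive when q is 0.\<close>
  have "0 < e / (\<bar>q\<bar> + 1)" using e by (intro divide_pos_pos) auto
  then obtain M where M: "\<And>a b. a \<ge> M \<Longrightarrow> b \<ge> M \<Longrightarrow> g (\<lambda>i. s a i - s b i) < e / (\<bar>q\<bar> + 1)"
    using s unfolding cauchy_mu_def by metis
  have "g (\<lambda>i. q * s a i - q * s b i) < e" if "a \<ge> M" "b \<ge> M" for a b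
  proof -
    have "g (\<lambda>i. q * s a i - q * s b i) = \<bar>q\<bar> * g (\<lambda>i. s a i - s b i)"
      using g_scale[of "\<lambda>i. s a i - s b i" q] s by (simp add: cauchy_mu_c00 c00_diff algebra_simps)
    also have "\<dots> \<le> (\<bar>q\<bar> + 1) * g (\<lambda>i. s a i - s b i)"
      by (intro mult_right_mono g_nonneg) simp
    also have "\<dots> < e"
      using M[OF that] by (simp add: field_simps)
    finally show ?thesis .
  qed
  then show "\<exists>N. \<forall>a\<ge>N. \<forall>b\<ge>N. g (\<lambda>i. q * s a i - q * s b i) < e" by blast
qed (use s in \<open>simp add: cauchy_mu_c00 c00_scale\<close>)

lemma cauchy_mu_diff:
  assumes "cauchy_mu \<mu> s" "cauchy_mu \<mu> t"
  shows "cauchy_mu \<mu> (\<lambda>n i. s n i - t n i)"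
  using cauchy_mu_add[OF assms(1) cauchy_mu_scale[OF assms(2), of "-1"]] by simp

section \<open>Classes of Cauchy sequences and independence of the representative\<close>

lemma equiv_mu_refl: "equiv_mu \<mu> s s"
  by (simp add: equiv_mu_def g_zero)

lemma equiv_mu_sym:
  "cauchy_mu \<mu> s \<Longrightarrow> cauchy_mu \<mu> t \<Longrightarrow> equiv_mu \<mu> s t \<Longrightarrow> equiv_mu \<mu> t s"
  unfolding equiv_mu_def by (subst g_diff_commute) (auto simp: cauchy_mu_c00)

lemma equiv_mu_trans:
  assumes "cauchy_mu \<mu> s" "cauchy_mu \<mu> t" "cauchy_mu \<mu> u" "equiv_mu \<mu> s t" "equiv_mu \<mu> t u"
  shows "equiv_mu \<mu> s u"
  unfolding equiv_mu_def
proof (rule Lim_null_comparison)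
  show "(\<lambda>n. g (\<lambda>i. s n i - t n i) + g (\<lambda>i. t n i - u n i)) \<longlonglongrightarrow> 0"
    using assms(4,5) unfolding equiv_mu_def by (rule tendsto_add_zero)
  show "\<forall>\<^sub>F n in sequentially. norm (g (\<lambda>i. s n i - u n i))
      \<le> g (\<lambda>i. s n i - t n i) + g (\<lambda>i. t n i - u n i)"
    using assms g_triangle by (simp add: cauchy_mu_c00 g_nonneg)
qed

lemma cls_eqI:
  assumes "cauchy_mu \<mu> s" "cauchy_mu \<mu> t" "equiv_mu \<mu> s t"
  shows "cls \<mu> s = cls \<mu> t"
  unfolding cls_def using assms equiv_mu_trans equiv_mu_sym by blast

lemma equiv_mu_if_cls_eq:
  assumes "cauchy_mu \<mu> t" "cls \<mu> s = cls \<mu> t"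
  shows "equiv_mu \<mu> s t"
  using assms equiv_mu_refl[of t] unfolding cls_def by blast

text \<open>A class contains its generating sequence, so the choice in \<open>rep\<close> is from a
  nonempty set. Norm, sum and multiple are later computed from any given sequence by means of this
  equivalence.\<close>

lemma rep_cls:
  assumes "cauchy_mu \<mu> s"
  shows "cauchy_mu \<mu> (rep (cls \<mu> s))" "equiv_mu \<mu> s (rep (cls \<mu> s))"
proof -
  have "s \<in> cls \<mu> s" using assms by (simp add: cls_def equiv_mu_refl)
  then have "rep (cls \<mu> s) \<in> cls \<mu> s" unfolding rep_def by (rule someI[where P = "\<lambda>t. t \<in> cls \<mu> s"])
  then show "cauchy_mu \<mu> (rep (cls \<mu> s))" "equiv_mu \<mu> s (rep (cls \<mu> s))"
    by (auto simp: cls_def)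
qed

lemma cls_in_Xcar: "cauchy_mu \<mu> s \<Longrightarrow> cls \<mu> s \<in> Xcar \<mu>"
  by (simp add: Xcar_def)

lemma XcarE:
  assumes "c \<in> Xcar \<mu>"
  obtains s where "cauchy_mu \<mu> s" "c = cls \<mu> s"
  using assms by (auto simp: Xcar_def)

lemma convergent_g:
  assumes "cauchy_mu \<mu> s"
  shows "convergent (\<lambda>n. g (s n))"
proof -
  have "Cauchy (\<lambda>n. g (s n))"
  proof (rule metric_CauchyI)
    fix e :: real assume "0 < e"
    then obtain N where N: "\<forall>a\<ge>N. \<forall>b\<ge>N. g (\<lambda>i. s a i - s b i) < e"
      using assms by (auto simp: cauchy_mu_def)
    show "\<exists>N. \<forall>a\<ge>N. \<forall>b\<ge>N. dist (g (s a)) (g (s b)) < e"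
      unfolding dist_real_def
      using N g_abs_diff_le assms by (meson cauchy_mu_c00 le_less_trans)
  qed
  then show ?thesis by (simp add: Cauchy_convergent_iff)
qed

lemma Xnorm_cls:
  assumes s: "cauchy_mu \<mu> s"
  shows "(\<lambda>n. g (s n)) \<longlonglongrightarrow> Xnorm \<mu> (cls \<mu> s)"
proof -
  let ?r = "rep (cls \<mu> s)"
  have 1: "(\<lambda>n. g (?r n)) \<longlonglongrightarrow> Xnorm \<mu> (cls \<mu> s)"
    using convergent_g[OF rep_cls(1)[OF s]] by (simp add: Xnorm_def convergent_LIMSEQ_iff)
  have "(\<lambda>n. g (s n) - g (?r n)) \<longlonglongrightarrow> 0"
    by (rule Lim_null_comparison[OF _ rep_cls(2)[OF s, unfolded equiv_mu_def]])
      (use s rep_cls(1)[OF s] in \<open>auto intro!: always_eventually g_abs_diff_le simp: cauchy_mu_c00\<close>)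
  from tendsto_add[OF this 1] show ?thesis by simp
qed

lemma Xadd_cls:
  assumes s: "cauchy_mu \<mu> s" and t: "cauchy_mu \<mu> t"
  shows "Xadd \<mu> (cls \<mu> s) (cls \<mu> t) = cls \<mu> (\<lambda>n i. s n i + t n i)"
  unfolding Xadd_def
proof (rule cls_eqI[symmetric])
  let ?r = "rep (cls \<mu> s)" and ?q = "rep (cls \<mu> t)"
  note r = rep_cls[OF s] and q = rep_cls[OF t]
  show "equiv_mu \<mu> (\<lambda>n i. s n i + t n i) (\<lambda>n i. ?r n i + ?q n i)"
    unfolding equiv_mu_def
  proof (rule Lim_null_comparison)
    show "(\<lambda>n. g (\<lambda>i. s n i - ?r n i) + g (\<lambda>i. t n i - ?q n i)) \<longlonglongrightarrow> 0"
      using r(2) q(2) unfolding equiv_mu_def by (rule tendsto_add_zero)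
    show "\<forall>\<^sub>F n in sequentially. norm (g (\<lambda>i. s n i + t n i - (?r n i + ?q n i)))
        \<le> g (\<lambda>i. s n i - ?r n i) + g (\<lambda>i. t n i - ?q n i)"
      using s t r(1) q(1) g_diff_add_le by (simp add: cauchy_mu_c00 g_nonneg)
  qed
qed (use s t rep_cls cauchy_mu_add in auto)

lemma Xscale_cls:
  assumes s: "cauchy_mu \<mu> s"
  shows "Xscale \<mu> a (cls \<mu> s) = cls \<mu> (\<lambda>n i. a * s n i)"
  unfolding Xscale_def
proof (rule cls_eqI[symmetric])
  let ?r = "rep (cls \<mu> s)"
  note r = rep_cls[OF s]
  have "g (\<lambda>i. a * s n i - a * ?r n i) = \<bar>a\<bar> * g (\<lambda>i. s n i - ?r n i)" for n
    using g_scale[of "\<lambda>i. s n i - ?r n i" a] s r(1)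
    by (simp add: cauchy_mu_c00 c00_diff algebra_simps)
  then show "equiv_mu \<mu> (\<lambda>n i. a * s n i) (\<lambda>n i. a * ?r n i)"
    using r(2) unfolding equiv_mu_def by (simp add: tendsto_mult_right_zero)
qed (use s rep_cls cauchy_mu_scale in auto)

lemma Xdist_cls:
  assumes "cauchy_mu \<mu> s" "cauchy_mu \<mu> t"
  shows "(\<lambda>n. g (\<lambda>i. s n i - t n i)) \<longlonglongrightarrow> Xdist \<mu> (cls \<mu> s) (cls \<mu> t)"
  using Xnorm_cls[OF cauchy_mu_diff[OF assms]]
    Xadd_cls[OF assms(1) cauchy_mu_scale[OF assms(2), of "-1"]]
  by (simp add: Xdist_def Xscale_cls assms(2))

lemma Xadd_closed: "c \<in> Xcar \<mu> \<Longrightarrow> d \<in> Xcar \<mu> \<Longrightarrow> Xadd \<mu> c d \<in> Xcar \<mu>"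
  by (elim XcarE) (simp add: Xadd_cls cls_in_Xcar cauchy_mu_add)

lemma Xscale_closed: "c \<in> Xcar \<mu> \<Longrightarrow> Xscale \<mu> a c \<in> Xcar \<mu>"
  by (elim XcarE) (simp add: Xscale_cls cls_in_Xcar cauchy_mu_scale)

lemma Xnorm_nonneg: "c \<in> Xcar \<mu> \<Longrightarrow> 0 \<le> Xnorm \<mu> c"
  by (elim XcarE) (auto intro: LIMSEQ_le_const[OF Xnorm_cls] simp: g_nonneg)

lemma Xnorm_Xscale:
  assumes "c \<in> Xcar \<mu>"
  shows "Xnorm \<mu> (Xscale \<mu> a c) = \<bar>a\<bar> * Xnorm \<mu> c"
proof -
  obtain s where s: "cauchy_mu \<mu> s" "c = cls \<mu> s" using assms by (rule XcarE)
  have "(\<lambda>n. g (\<lambda>i. a * s n i)) \<longlonglongrightarrow> Xnorm \<mu> (Xscale \<mu> a c)"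
    using s Xnorm_cls[OF cauchy_mu_scale[OF s(1)]] by (simp add: Xscale_cls)
  moreover have "(\<lambda>n. g (\<lambda>i. a * s n i)) \<longlonglongrightarrow> \<bar>a\<bar> * Xnorm \<mu> c"
    using s by (simp add: g_scale cauchy_mu_c00 Xnorm_cls tendsto_mult_left)
  ultimately show ?thesis by (rule LIMSEQ_unique)
qed

lemma Xdist_commute:
  assumes "c \<in> Xcar \<mu>" "d \<in> Xcar \<mu>"
  shows "Xdist \<mu> c d = Xdist \<mu> d c"
proof -
  obtain s t where st: "cauchy_mu \<mu> s" "c = cls \<mu> s" "cauchy_mu \<mu> t" "d = cls \<mu> t"
    using assms by (metis XcarE)
  have "g (\<lambda>i. s n i - t n i) = g (\<lambda>i. t n i - s n i)" for n
    using st by (intro g_diff_commute cauchy_mu_c00)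
  then show ?thesis
    using Xdist_cls[of s t] Xdist_cls[of t s] st by (simp add: LIMSEQ_unique)
qed

lemma Xdist_triangle:
  assumes "b \<in> Xcar \<mu>" "c \<in> Xcar \<mu>" "d \<in> Xcar \<mu>"
  shows "Xdist \<mu> b d \<le> Xdist \<mu> b c + Xdist \<mu> c d"
proof -
  obtain r s t where "cauchy_mu \<mu> r" "b = cls \<mu> r" "cauchy_mu \<mu> s" "c = cls \<mu> s"
    "cauchy_mu \<mu> t" "d = cls \<mu> t"
    using assms by (metis XcarE)
  then show ?thesis
    using LIMSEQ_le[OF Xdist_cls[of r t] tendsto_add[OF Xdist_cls[of r s] Xdist_cls[of s t]]]
      g_triangle by (simp add: cauchy_mu_c00)
qed

lemma Xnorm_diff_le:
  assumes "c \<in> Xcar \<mu>" "d \<in> Xcar \<mu>"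
  shows "\<bar>Xnorm \<mu> c - Xnorm \<mu> d\<bar> \<le> Xdist \<mu> c d"
proof -
  obtain s t where st: "cauchy_mu \<mu> s" "c = cls \<mu> s" "cauchy_mu \<mu> t" "d = cls \<mu> t"
    using assms by (metis XcarE)
  have "(\<lambda>n. \<bar>g (s n) - g (t n)\<bar>) \<longlonglongrightarrow> \<bar>Xnorm \<mu> c - Xnorm \<mu> d\<bar>"
    unfolding st by (intro tendsto_intros Xnorm_cls st)
  moreover have "(\<lambda>n. g (\<lambda>i. s n i - t n i)) \<longlonglongrightarrow> Xdist \<mu> c d"
    unfolding st by (rule Xdist_cls[OF st(1,3)])
  ultimately show ?thesis
    by (rule LIMSEQ_le) (use st g_abs_diff_le in \<open>simp add: cauchy_mu_c00\<close>)
qed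

lemma Xdist_Xscale:
  assumes "c \<in> Xcar \<mu>" "d \<in> Xcar \<mu>"
  shows "Xdist \<mu> (Xscale \<mu> a c) (Xscale \<mu> a d) = \<bar>a\<bar> * Xdist \<mu> c d"
proof -
  obtain s t where st: "cauchy_mu \<mu> s" "c = cls \<mu> s" "cauchy_mu \<mu> t" "d = cls \<mu> t"
    using assms by (metis XcarE)
  have eq: "g (\<lambda>i. a * s n i - a * t n i) = \<bar>a\<bar> * g (\<lambda>i. s n i - t n i)" for n
    using g_scale[of "\<lambda>i. s n i - t n i" a] st by (simp add: cauchy_mu_c00 c00_diff algebra_simps)
  have "(\<lambda>n. g (\<lambda>i. a * s n i - a * t n i)) \<longlonglongrightarrow> Xdist \<mu> (Xscale \<mu> a c) (Xscale \<mu> a d)"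
    using st Xdist_cls[OF cauchy_mu_scale[OF st(1)] cauchy_mu_scale[OF st(3)]]
    by (simp add: Xscale_cls)
  moreover have "(\<lambda>n. g (\<lambda>i. a * s n i - a * t n i)) \<longlonglongrightarrow> \<bar>a\<bar> * Xdist \<mu> c d"
    unfolding eq st by (intro tendsto_mult_left Xdist_cls st)
  ultimately show ?thesis by (rule LIMSEQ_unique)
qed

text \<open>Measures the displacement when a vector of norm slightly above 1 is pulled back into the
  unit ball.\<close>

lemma Xdist_Xscale_self:
  assumes "c \<in> Xcar \<mu>"
  shows "Xdist \<mu> c (Xscale \<mu> a c) = \<bar>1 - a\<bar> * Xnorm \<mu> c"
proof -
  obtain s where s: "cauchy_mu \<mu> s" "c = cls \<mu> s" using assms by (rule XcarE)
  have "Xadd \<mu> c (Xscale \<mu> (-1) (Xscale \<mu> a c)) = Xscale \<mu> (1 - a) c"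
    unfolding s(2) Xscale_cls[OF s(1)] Xscale_cls[OF cauchy_mu_scale[OF s(1)]]
      Xadd_cls[OF s(1) cauchy_mu_scale[OF cauchy_mu_scale[OF s(1)]]]
    by (simp add: algebra_simps)
  then show ?thesis
    using assms by (simp add: Xdist_def Xnorm_Xscale)
qed

lemma Xembed_closed: "x \<in> c00 \<Longrightarrow> Xembed \<mu> x \<in> Xcar \<mu>"
  by (simp add: Xembed_def cls_in_Xcar cauchy_mu_const)

lemma Xadd_Xembed: "x \<in> c00 \<Longrightarrow> y \<in> c00 \<Longrightarrow> Xadd \<mu> (Xembed \<mu> x) (Xembed \<mu> y) = Xembed \<mu> (\<lambda>i. x i + y i)"
  by (simp add: Xembed_def Xadd_cls cauchy_mu_const)

lemma Xscale_Xembed: "x \<in> c00 \<Longrightarrow> Xscale \<mu> a (Xembed \<mu> x) = Xembed \<mu> (\<lambda>i. a * x i)"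
  by (simp add: Xembed_def Xscale_cls cauchy_mu_const)

lemma Xnorm_Xembed: "x \<in> c00 \<Longrightarrow> Xnorm \<mu> (Xembed \<mu> x) = g x"
  using Xnorm_cls[OF cauchy_mu_const] by (simp add: Xembed_def LIMSEQ_const_iff)

lemma Xdist_Xembed: "x \<in> c00 \<Longrightarrow> y \<in> c00 \<Longrightarrow> Xdist \<mu> (Xembed \<mu> x) (Xembed \<mu> y) = g (\<lambda>i. x i - y i)"
  using Xdist_cls[OF cauchy_mu_const cauchy_mu_const] by (simp add: Xembed_def LIMSEQ_const_iff)

lemma Xembed_eq_Xzero: "x \<in> c00 \<Longrightarrow> Xembed \<mu> x = Xzero \<mu> \<Longrightarrow> g x = 0"
  using equiv_mu_if_cls_eq[OF cauchy_mu_const[OF c00_zero], of "\<lambda>_. x"]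
  by (simp add: Xembed_def Xzero_def equiv_mu_def LIMSEQ_const_iff)

text \<open>A late term \<open>s N\<close> is close to the class and a rational vector is close to
  \<open>s N\<close>, each within e/3. The limit preserves only weak inequalities, so the bound 2e/3
  leaves room for the strict one.\<close>

lemma Xembed_dense:
  assumes "c \<in> Xcar \<mu>" "0 < e"
  obtains v where "v \<in> Vset" "Xdist \<mu> c (Xembed \<mu> (real_vec v)) < e"
proof -
  obtain s where s: "cauchy_mu \<mu> s" "c = cls \<mu> s" using assms(1) by (rule XcarE)
  obtain N where N: "\<forall>a\<ge>N. \<forall>b\<ge>N. g (\<lambda>i. s a i - s b i) < e / 3"
    using s(1) assms(2) by (metis cauchy_mu_def zero_less_divide_iff zero_less_numeral)
  obtain v where v: "v \<in> Vset" "g (\<lambda>i. s N i - real_vec v i) < e / 3"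
    using seminorm_c00_rat_dense[OF seminorm_c00_mu_bar cauchy_mu_c00[OF s(1), of N], of "e / 3"]
      assms(2) by auto
  have "(\<lambda>n. g (\<lambda>i. s n i - real_vec v i)) \<longlonglongrightarrow> Xdist \<mu> c (Xembed \<mu> (real_vec v))"
    unfolding s(2) Xembed_def by (intro Xdist_cls s cauchy_mu_const c00_real_vec v)
  moreover have "g (\<lambda>i. s n i - real_vec v i) \<le> 2 * e / 3" if "n \<ge> N" for n
  proof -
    have "g (\<lambda>i. s n i - s N i) < e / 3" using N that by simp
    then show ?thesis
      using v(2) g_triangle[of "s n" "s N" "real_vec v"] s(1) v(1)
      by (simp add: cauchy_mu_c00 c00_real_vec)
  qed
  ultimately have "Xdist \<mu> c (Xembed \<mu> (real_vec v)) \<le> 2 * e / 3"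
    by (intro LIMSEQ_le_const2) auto
  then show ?thesis using that[OF v(1)] assms(2) by simp
qed

text \<open>Domination by the seminorm sends Cauchy sequences to Cauchy sequences and equivalent
  ones to the same limit, so the limit is well defined on classes.\<close>

lemma Xfunctional_extension:
  assumes add: "\<And>x y. x \<in> c00 \<Longrightarrow> y \<in> c00 \<Longrightarrow> f (\<lambda>i. x i + y i) = f x + f y"
    and scale: "\<And>a x. x \<in> c00 \<Longrightarrow> f (\<lambda>i. a * x i) = a * f x"
    and bound: "\<And>x. x \<in> c00 \<Longrightarrow> \<bar>f x\<bar> \<le> g x"
  obtains F where "\<And>c d. c \<in> Xcar \<mu> \<Longrightarrow> d \<in> Xcar \<mu> \<Longrightarrow> F (Xadd \<mu> c d) = F c + F d"
    "\<And>a c. c \<in> Xcar \<mu> \<Longrightarrow> F (Xscale \<mu> a c) = a * F c"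
    "\<And>c. c \<in> Xcar \<mu> \<Longrightarrow> \<bar>F c\<bar> \<le> Xnorm \<mu> c"
    "\<And>x. x \<in> c00 \<Longrightarrow> F (Xembed \<mu> x) = f x"
proof -
  have diff: "f (\<lambda>i. x i - y i) = f x - f y" if "x \<in> c00" "y \<in> c00" for x y
    using add[of x "\<lambda>i. -1 * y i"] scale[of y "-1"] c00_scale[of y "-1"] that by simp
  have fdiff: "\<bar>f x - f y\<bar> \<le> g (\<lambda>i. x i - y i)" if "x \<in> c00" "y \<in> c00" for x y
    using bound[OF c00_diff[OF that]] diff[OF that] by simp
  define F where "F c = lim (\<lambda>n. f (rep c n))" for c
  have F: "(\<lambda>n. f (s n)) \<longlonglongrightarrow> F (cls \<mu> s)" if s: "cauchy_mu \<mu> s" for s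
  proof -
    let ?r = "rep (cls \<mu> s)"
    note r = rep_cls[OF s]
    have "Cauchy (\<lambda>n. f (?r n))"
    proof (rule metric_CauchyI)
      fix e :: real assume "0 < e"
      then obtain N where N: "\<forall>a\<ge>N. \<forall>b\<ge>N. g (\<lambda>i. ?r a i - ?r b i) < e"
        using r(1) by (auto simp: cauchy_mu_def)
      show "\<exists>N. \<forall>a\<ge>N. \<forall>b\<ge>N. dist (f (?r a)) (f (?r b)) < e"
        unfolding dist_real_def
        using N fdiff r(1) by (meson cauchy_mu_c00 le_less_trans)
    qed
    then have 1: "(\<lambda>n. f (?r n)) \<longlonglongrightarrow> F (cls \<mu> s)"
      by (simp add: F_def Cauchy_convergent_iff convergent_LIMSEQ_iff)
    have "(\<lambda>n. f (s n) - f (?r n)) \<longlonglongrightarrow> 0"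
      by (rule Lim_null_comparison[OF _ r(2)[unfolded equiv_mu_def]])
        (use s r(1) in \<open>auto intro!: always_eventually fdiff simp: cauchy_mu_c00\<close>)
    from tendsto_add[OF this 1] show ?thesis by simp
  qed
  show ?thesis
  proof
    fix c d assume "c \<in> Xcar \<mu>" "d \<in> Xcar \<mu>"
    then obtain s t where st: "cauchy_mu \<mu> s" "c = cls \<mu> s" "cauchy_mu \<mu> t" "d = cls \<mu> t"
      by (metis XcarE)
    show "F (Xadd \<mu> c d) = F c + F d"
      using F[OF cauchy_mu_add[OF st(1,3)]] tendsto_add[OF F[OF st(1)] F[OF st(3)]] st
      by (simp add: Xadd_cls add cauchy_mu_c00 LIMSEQ_unique)
  next
    fix a c assume "c \<in> Xcar \<mu>"
    then obtain s where s: "cauchy_mu \<mu> s" "c = cls \<mu> s" by (rule XcarE)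
    show "F (Xscale \<mu> a c) = a * F c"
      using F[OF cauchy_mu_scale[OF s(1), of a]] tendsto_mult_left[OF F[OF s(1)], of a] s
      by (simp add: Xscale_cls scale cauchy_mu_c00 LIMSEQ_unique)
  next
    fix c assume "c \<in> Xcar \<mu>"
    then obtain s where s: "cauchy_mu \<mu> s" "c = cls \<mu> s" by (rule XcarE)
    show "\<bar>F c\<bar> \<le> Xnorm \<mu> c"
      using LIMSEQ_le[OF tendsto_rabs[OF F[OF s(1)]] Xnorm_cls[OF s(1)]] s bound
      by (simp add: cauchy_mu_c00)
  next
    fix x assume "x \<in> c00"
    then show "F (Xembed \<mu> x) = f x"
      using F[OF cauchy_mu_const] by (simp add: Xembed_def LIMSEQ_const_iff)
  qed
qed

end

subsection \<open>Hahn--Banach over the rationals\<close>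

definition sublinear_V :: "((nat \<Rightarrow> rat) \<Rightarrow> real) \<Rightarrow> bool" where
  "sublinear_V p \<longleftrightarrow>
     (\<forall>x\<in>Vset. \<forall>y\<in>Vset. p (\<lambda>i. x i + y i) \<le> p x + p y) \<and>
     (\<forall>q>0. \<forall>x\<in>Vset. p (\<lambda>i. q * x i) = real_of_rat q * p x)"

definition linear_V :: "((nat \<Rightarrow> rat) \<Rightarrow> real) \<Rightarrow> bool" where
  "linear_V f \<longleftrightarrow>
     (\<forall>x\<in>Vset. \<forall>y\<in>Vset. f (\<lambda>i. x i + y i) = f x + f y) \<and>
     (\<forall>q. \<forall>x\<in>Vset. f (\<lambda>i. q * x i) = real_of_rat q * f x)"

text \<open>The reverse inequality is the assumed one for the inverse of q and the vector q
  x.\<close>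

lemma sublinear_VI:
  assumes "\<And>x y. x \<in> Vset \<Longrightarrow> y \<in> Vset \<Longrightarrow> p (\<lambda>i. x i + y i) \<le> p x + p y"
    and scale: "\<And>q x. 0 < q \<Longrightarrow> x \<in> Vset \<Longrightarrow> p (\<lambda>i. q * x i) \<le> real_of_rat q * p x"
  shows "sublinear_V p"
  unfolding sublinear_V_def
proof (intro conjI ballI allI impI)
  fix q :: rat and x assume q: "0 < q" and x: "x \<in> Vset"
  have "p x \<le> real_of_rat (inverse q) * p (\<lambda>i. q * x i)"
    using scale[OF _ Vset_scale[OF x], of "inverse q" q] q by (simp add: field_simps)
  then have "real_of_rat q * p x \<le> p (\<lambda>i. q * x i)"
    using q by (simp only: of_rat_inverse) (simp add: field_simps)
  with scale[OF q x] show "p (\<lambda>i. q * x i) = real_of_rat q * p x" by simp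
qed (fact assms(1))

lemma sublinear_V_add: "sublinear_V p \<Longrightarrow> x \<in> Vset \<Longrightarrow> y \<in> Vset \<Longrightarrow> p (\<lambda>i. x i + y i) \<le> p x + p y"
  by (simp add: sublinear_V_def)

lemma sublinear_V_scale: "sublinear_V p \<Longrightarrow> x \<in> Vset \<Longrightarrow> 0 < q \<Longrightarrow> p (\<lambda>i. q * x i) = real_of_rat q * p x"
  by (simp add: sublinear_V_def)

lemma sublinear_V_zero: "sublinear_V p \<Longrightarrow> p (\<lambda>i. 0) = 0"
  using sublinear_V_scale[OF _ Vset_zero, of p 2] by simp

lemma Vset_uminus: "x \<in> Vset \<Longrightarrow> (\<lambda>i. - x i) \<in> Vset"
  using Vset_scale[of x "-1"] by simp

lemma sublinear_V_ge: "sublinear_V p \<Longrightarrow> x \<in> Vset \<Longrightarrow> - p (\<lambda>i. - x i) \<le> p x"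
  using sublinear_V_add[of p x "\<lambda>i. - x i"] sublinear_V_zero[of p] Vset_uminus[of x] by simp

text \<open>The common tool for three infima: over a chain in Zorn's lemma, over perturbations of a
  minimal functional, and over the cone in \<open>cone_separation\<close>. The index k may depend on
  the vectors, which covers chains and cones alike.\<close>

lemma sublinear_V_INF:
  fixes \<phi> :: "'i \<Rightarrow> (nat \<Rightarrow> rat) \<Rightarrow> real"
  assumes ne: "I \<noteq> {}"
    and bdd: "\<And>x. x \<in> Vset \<Longrightarrow> \<exists>b. \<forall>i\<in>I. b \<le> \<phi> i x"
    and add: "\<And>i j x y. i \<in> I \<Longrightarrow> j \<in> I \<Longrightarrow> x \<in> Vset \<Longrightarrow> y \<in> Vset \<Longrightarrow>
      \<exists>k\<in>I. \<phi> k (\<lambda>l. x l + y l) \<le> \<phi> i x + \<phi> j y"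
    and scale: "\<And>i q x. i \<in> I \<Longrightarrow> 0 < q \<Longrightarrow> x \<in> Vset \<Longrightarrow>
      \<exists>k\<in>I. \<phi> k (\<lambda>l. q * x l) \<le> real_of_rat q * \<phi> i x"
  defines "u \<equiv> \<lambda>x. if x \<in> Vset then (INF i\<in>I. \<phi> i x) else 0"
  shows "sublinear_V u \<and> (\<forall>i\<in>I. \<forall>x\<in>Vset. u x \<le> \<phi> i x)"
proof -
  have le: "u x \<le> \<phi> i x" if "i \<in> I" "x \<in> Vset" for i x
    unfolding u_def using bdd[OF that(2)] that by (auto intro!: cINF_lower simp: bdd_below_def)
  have ge: "b \<le> u x" if "x \<in> Vset" "\<And>i. i \<in> I \<Longrightarrow> b \<le> \<phi> i x" for b x
    unfolding u_def using that ne by (auto intro!: cINF_greatest)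
  have "sublinear_V u"
  proof (rule sublinear_VI)
    fix x y assume x: "x \<in> Vset" and y: "y \<in> Vset"
    \<comment> \<open>The two infima are taken in turn: j varies with i fixed, then i
      varies.\<close>
    have "u (\<lambda>l. x l + y l) - \<phi> i x \<le> u y" if i: "i \<in> I" for i
    proof (rule ge[OF y])
      fix j assume "j \<in> I"
      then obtain k where "k \<in> I" "\<phi> k (\<lambda>l. x l + y l) \<le> \<phi> i x + \<phi> j y"
        using add i x y by blast
      then show "u (\<lambda>l. x l + y l) - \<phi> i x \<le> \<phi> j y"
        using le[of k "\<lambda>l. x l + y l"] Vset_add[OF x y] by linarith
    qed
    then have "u (\<lambda>l. x l + y l) - u y \<le> u x"
      by (intro ge x) (simp add: algebra_simps)
    then show "u (\<lambda>l. x l + y l) \<le> u x + u y" by simp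
  next
    fix q :: rat and x assume q: "0 < q" and x: "x \<in> Vset"
    have "u (\<lambda>l. q * x l) / real_of_rat q \<le> u x"
    proof (rule ge[OF x])
      fix i assume "i \<in> I"
      then obtain k where "k \<in> I" "\<phi> k (\<lambda>l. q * x l) \<le> real_of_rat q * \<phi> i x"
        using scale q x by blast
      then have "u (\<lambda>l. q * x l) \<le> real_of_rat q * \<phi> i x"
        using le[of k "\<lambda>l. q * x l"] Vset_scale[OF x] by (meson order_trans)
      then show "u (\<lambda>l. q * x l) / real_of_rat q \<le> \<phi> i x"
        using q by (simp add: field_simps)
    qed
    then show "u (\<lambda>l. q * x l) \<le> real_of_rat q * u x"
      using q by (simp add: field_simps)
  qed
  with le show ?thesis by blast
qed

text \<open>The infimum over t >= 0 of m(x + t y) - t m(y) is sublinear and below m, hence equals m;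
  its value at -y, bounded by the term t = 1, gives m(-y) <= -m(y). A sublinear functional that is
  odd is linear.\<close>

lemma linear_V_if_minimal:
  assumes m: "sublinear_V m" and min: "\<And>q x. sublinear_V q \<Longrightarrow> (\<And>x. x \<in> Vset \<Longrightarrow> q x \<le> m x) \<Longrightarrow>
    x \<in> Vset \<Longrightarrow> q x = m x"
  shows "linear_V m"
proof -
  have neg: "m (\<lambda>i. - y i) = - m y" if y: "y \<in> Vset" for y
  proof -
    define \<phi> where "\<phi> t x = m (\<lambda>i. x i + t * y i) - real_of_rat t * m y" for t x
    define u where "u x = (if x \<in> Vset then (INF t\<in>{0..}. \<phi> t x) else 0)" for x
    have mty: "m (\<lambda>i. t * y i) = real_of_rat t * m y" if "t \<ge> 0" for t
      using sublinear_V_scale[OF m y, of t] sublinear_V_zero[OF m] that by (cases "t = 0") auto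
    \<comment> \<open>This is t m(y) = m(t y) <= m(x + t y) + m(-x).\<close>
    have bdd: "- m (\<lambda>i. - x i) \<le> \<phi> t x" if "x \<in> Vset" "t \<ge> 0" for x t
      using sublinear_V_add[OF m, of "\<lambda>i. x i + t * y i" "\<lambda>i. - x i"] that y mty
      by (simp add: \<phi>_def Vset_add Vset_scale Vset_uminus)
    have "sublinear_V u \<and> (\<forall>t\<in>{0..}. \<forall>x\<in>Vset. u x \<le> \<phi> t x)"
      unfolding u_def
    proof (rule sublinear_V_INF)
      fix t s :: rat and x x' assume "t \<in> {0..}" "s \<in> {0..}" "x \<in> Vset" "x' \<in> Vset"
      then show "\<exists>k\<in>{0..}. \<phi> k (\<lambda>l. x l + x' l) \<le> \<phi> t x + \<phi> s x'"
        using sublinear_V_add[OF m, of "\<lambda>i. x i + t * y i" "\<lambda>i. x' i + s * y i"] y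
        by (intro bexI[of _ "t + s"]) (auto simp: \<phi>_def Vset_add Vset_scale algebra_simps of_rat_add)
    next
      fix t q :: rat and x assume "t \<in> {0..}" "0 < q" "x \<in> Vset"
      then show "\<exists>k\<in>{0..}. \<phi> k (\<lambda>l. q * x l) \<le> real_of_rat q * \<phi> t x"
        using sublinear_V_scale[OF m, of "\<lambda>i. x i + t * y i" q] y
        by (intro bexI[of _ "q * t"]) (auto simp: \<phi>_def Vset_add Vset_scale algebra_simps of_rat_mult)
    qed (use bdd in auto)
    then have sub: "sublinear_V u" "\<And>t x. t \<ge> 0 \<Longrightarrow> x \<in> Vset \<Longrightarrow> u x \<le> \<phi> t x"
      by auto
    have "u (\<lambda>i. - y i) = m (\<lambda>i. - y i)"
      using sub(2)[of 0] y by (intro min sub(1) Vset_uminus) (auto simp: \<phi>_def)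
    moreover have "u (\<lambda>i. - y i) \<le> - m y"
      using sub(2)[of 1 "\<lambda>i. - y i"] y by (simp add: \<phi>_def Vset_uminus sublinear_V_zero[OF m])
    ultimately show ?thesis
      using sublinear_V_ge[OF m y] by linarith
  qed
  show ?thesis
    unfolding linear_V_def
  proof (intro conjI ballI allI)
    fix x y assume "x \<in> Vset" "y \<in> Vset"
    then show "m (\<lambda>i. x i + y i) = m x + m y"
      using sublinear_V_add[OF m, of x y] sublinear_V_add[OF m, of "\<lambda>i. x i + y i" "\<lambda>i. - y i"]
        neg[of y] by (simp add: Vset_add Vset_uminus)
  next
    fix q :: rat and x assume x: "x \<in> Vset"
    consider "q = 0" | "q > 0" | "- q > 0" by linarith
    then show "m (\<lambda>i. q * x i) = real_of_rat q * m x"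
    proof cases
      case 3
      then show ?thesis
        using sublinear_V_scale[OF m x 3] neg[OF Vset_scale[OF x, of q]] by (simp add: of_rat_minus)
    qed (use sublinear_V_scale[OF m x] sublinear_V_zero[OF m] in auto)
  qed
qed

text \<open>Zorn's lemma yields a minimal sublinear functional below p, which is linear; no linear
  functional on a subspace has to be extended.\<close>

lemma Hahn_Banach_V:
  assumes p: "sublinear_V p"
  obtains f where "linear_V f" "\<And>x. x \<in> Vset \<Longrightarrow> f x \<le> p x"
proof -
  \<comment> \<open>Vanishing off \<open>Vset\<close> lets the pointwise order on the whole type
    replace the order on \<open>Vset\<close>, so minimality is an equality of functions.\<close>
  define A where "A = {q. sublinear_V q \<and> (\<forall>x\<in>Vset. q x \<le> p x) \<and> (\<forall>x. x \<notin> Vset \<longrightarrow> q x = 0)}"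
  have "\<exists>m\<in>A. \<forall>q\<in>A. m \<ge> q \<longrightarrow> q = m"
  proof (rule predicate_Zorn)
    show "partial_order_on A (relation_of (\<ge>) A)"
      by (rule partial_order_on_relation_ofI) auto
    fix C assume C: "C \<in> Chains (relation_of (\<ge>) A)"
    then have CA: "C \<subseteq> A" by (rule Chains_relation_of)
    show "\<exists>u\<in>A. \<forall>a\<in>C. a \<ge> u"
    proof (cases "C = {}")
      case True
      have "(\<lambda>x. if x \<in> Vset then p x else 0) \<in> A"
        using p by (auto simp: A_def sublinear_V_def Vset_add Vset_scale)
      with True show ?thesis by auto
    next
      case False
      define u where "u x = (if x \<in> Vset then (INF q\<in>C. q x) else 0)" for x
      have sub: "q \<in> C \<Longrightarrow> sublinear_V q" for q using CA by (auto simp: A_def)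
      have "sublinear_V u \<and> (\<forall>q\<in>C. \<forall>x\<in>Vset. u x \<le> q x)"
        unfolding u_def
      proof (rule sublinear_V_INF)
        fix x assume x: "x \<in> Vset"
        have "- p (\<lambda>i. - x i) \<le> q x" if "q \<in> C" for q
          using sublinear_V_ge[OF sub[OF that] x] CA that Vset_uminus[OF x] by (force simp: A_def)
        then show "\<exists>b. \<forall>q\<in>C. b \<le> q x" by blast
      next
        fix q r x y assume qr: "q \<in> C" "r \<in> C" and xy: "x \<in> Vset" "y \<in> Vset"
        \<comment> \<open>The smaller of two members of the chain serves for both summands.\<close>
        have "q \<le> r \<or> r \<le> q"
          using C qr by (auto simp: Chains_def relation_of_def)
        then show "\<exists>k\<in>C. k (\<lambda>l. x l + y l) \<le> q x + r y"
        proof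
          assume "q \<le> r"
          then show ?thesis
            using qr sublinear_V_add[OF sub[OF qr(1)] xy] by (auto intro!: bexI[of _ q] dest: le_funD[of _ _ y])
        next
          assume "r \<le> q"
          then show ?thesis
            using qr sublinear_V_add[OF sub[OF qr(2)] xy] by (auto intro!: bexI[of _ r] dest: le_funD[of _ _ x])
        qed
      next
        fix q a x assume "q \<in> C" "0 < (a::rat)" "x \<in> Vset"
        then show "\<exists>k\<in>C. k (\<lambda>l. a * x l) \<le> real_of_rat a * q x"
          using sublinear_V_scale[OF sub] by (intro bexI[of _ q]) auto
      qed (use False in auto)
      then have u: "sublinear_V u" "\<And>q x. q \<in> C \<Longrightarrow> x \<in> Vset \<Longrightarrow> u x \<le> q x"
        by auto
      obtain q0 where "q0 \<in> C" using False by blast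
      then have "u x \<le> p x" if "x \<in> Vset" for x
        using u(2)[OF _ that] CA that by (force simp: A_def)
      then have "u \<in> A"
        using u(1) by (auto simp: A_def) (auto simp: u_def)
      moreover have "u \<le> q" if "q \<in> C" for q
        using u(2)[OF that] CA that by (intro le_funI) (auto simp: u_def A_def)
      ultimately show ?thesis by blast
    qed
  qed
  then obtain m where m: "m \<in> A" and min: "\<And>q. q \<in> A \<Longrightarrow> q \<le> m \<Longrightarrow> q = m" by blast
  show ?thesis
  proof
    show "linear_V m"
    proof (rule linear_V_if_minimal)
      show "sublinear_V m" using m by (simp add: A_def)
      fix q x assume q: "sublinear_V q" "\<And>x. x \<in> Vset \<Longrightarrow> q x \<le> m x" and x: "x \<in> Vset"
      let ?q = "\<lambda>x. if x \<in> Vset then q x else 0"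
      have "q x \<le> p x" if "x \<in> Vset" for x
        using q(2)[OF that] m that by (force simp: A_def)
      then have "?q \<in> A"
        using q(1) by (auto simp: A_def sublinear_V_def Vset_add Vset_scale)
      moreover have "?q \<le> m"
        using q m by (auto simp: le_fun_def A_def)
      ultimately show "q x = m x" using min[of ?q] x by (auto dest: fun_cong[of _ _ x])
    qed
    show "\<And>x. x \<in> Vset \<Longrightarrow> m x \<le> p x" using m by (simp add: A_def)
  qed
qed

lemma linear_V_add: "linear_V f \<Longrightarrow> x \<in> Vset \<Longrightarrow> y \<in> Vset \<Longrightarrow> f (\<lambda>i. x i + y i) = f x + f y"
  by (simp add: linear_V_def)

lemma linear_V_scale: "linear_V f \<Longrightarrow> x \<in> Vset \<Longrightarrow> f (\<lambda>i. q * x i) = real_of_rat q * f x"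
  by (simp add: linear_V_def)

lemma linear_V_zero: "linear_V f \<Longrightarrow> f (\<lambda>i. 0) = 0"
  using linear_V_scale[OF _ Vset_zero, of f 0] by simp

lemma linear_V_uminus: "linear_V f \<Longrightarrow> x \<in> Vset \<Longrightarrow> f (\<lambda>i. - x i) = - f x"
  using linear_V_scale[of f x "-1"] by simp

lemma linear_V_diff: "linear_V f \<Longrightarrow> x \<in> Vset \<Longrightarrow> y \<in> Vset \<Longrightarrow> f (\<lambda>i. x i - y i) = f x - f y"
  using linear_V_add[of f x "\<lambda>i. - y i"] linear_V_uminus[of f y] Vset_uminus[of y] by simp

lemma linear_V_eq_sum:
  assumes f: "linear_V f" and S: "finite S" "\<And>i. i \<notin> S \<Longrightarrow> v i = 0"
  shows "f v = (\<Sum>i\<in>S. real_vec v i * f (unit_vec i))"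
  using S
proof (induction S arbitrary: v rule: finite_induct)
  case empty
  then have "v = (\<lambda>i. 0)" by auto
  then show ?case by (simp add: linear_V_zero[OF f])
next
  case (insert j S)
  define w where "w = (\<lambda>i. if i = j then 0 else v i)"
  have "f v = f (\<lambda>i. w i + v j * unit_vec j i)"
    by (rule arg_cong[of _ _ f]) (auto simp: w_def unit_vec_def)
  also have "\<dots> = f w + f (\<lambda>i. v j * unit_vec j i)"
    using insert by (intro linear_V_add f Vset_scale Vset_unit_vec Vset_supported[of S])
      (auto simp: w_def)
  also have "f w = (\<Sum>i\<in>S. real_vec w i * f (unit_vec i))"
    using insert by (intro insert.IH) (auto simp: w_def)
  also have "\<dots> = (\<Sum>i\<in>S. real_vec v i * f (unit_vec i))"
    using insert by (intro sum.cong) (auto simp: w_def real_vec_def)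
  finally show ?case
    using insert by (simp add: linear_V_scale[OF f] Vset_unit_vec real_vec_def)
qed

subsection \<open>The DLD2P as a countable condition\<close>

text \<open>For nonnegative weights of positive total w this is w times the difference of x and a
  convex combination. Appending and rescaling lists then correspond to the cone operations.\<close>

definition diff_comb :: "(nat \<Rightarrow> rat) \<Rightarrow> (rat \<times> (nat \<Rightarrow> rat)) list \<Rightarrow> nat \<Rightarrow> rat" where
  "diff_comb x L i = (\<Sum>p\<leftarrow>L. fst p * (x i - snd p i))"

definition weight :: "(rat \<times> (nat \<Rightarrow> rat)) list \<Rightarrow> rat" where
  "weight L = (\<Sum>p\<leftarrow>L. fst p)"

text \<open>The errors in \<open>diametral_set\<close> are additive rather than relative to \<open>\<mu> x\<close>, so that vectors with
  \<open>\<mu> x = 0\<close> need no separate treatment.\<close>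
definition diametral_set :: "((nat \<Rightarrow> rat) \<Rightarrow> real) \<Rightarrow> (nat \<Rightarrow> rat) \<Rightarrow> real \<Rightarrow> (nat \<Rightarrow> rat) set" where
  "diametral_set \<mu> x e = {y \<in> Vset. \<mu> y < \<mu> x + e \<and> 2 * \<mu> x - e < \<mu> (\<lambda>i. x i - y i)}"

text \<open>The homogeneous form of: x is closer than e to a rational convex combination of
  \<open>diametral_set \<mu> x e\<close>.\<close>

definition diametral_at :: "((nat \<Rightarrow> rat) \<Rightarrow> real) \<Rightarrow> (nat \<Rightarrow> rat) \<Rightarrow> real \<Rightarrow> bool" where
  "diametral_at \<mu> x e \<longleftrightarrow>
     (\<exists>L. (\<forall>p\<in>set L. 0 \<le> fst p \<and> snd p \<in> diametral_set \<mu> x e) \<and> 0 < weight L \<and>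
        \<mu> (diff_comb x L) < e * real_of_rat (weight L))"

lemma diff_comb_Nil: "diff_comb x [] = (\<lambda>i. 0)"
  by (simp add: diff_comb_def fun_eq_iff)

lemma diff_comb_Cons: "diff_comb x (p # L) = (\<lambda>i. fst p * (x i - snd p i) + diff_comb x L i)"
  by (simp add: diff_comb_def fun_eq_iff)

lemma diff_comb_append: "diff_comb x (L @ M) = (\<lambda>i. diff_comb x L i + diff_comb x M i)"
  by (simp add: diff_comb_def fun_eq_iff)

lemma diff_comb_scale: "diff_comb x (map (map_prod ((*) q) id) L) = (\<lambda>i. q * diff_comb x L i)"
  by (induction L) (auto simp: diff_comb_def fun_eq_iff algebra_simps)

lemma weight_scale: "weight (map (map_prod ((*) q) id) L) = q * weight L"
  by (induction L) (auto simp: weight_def algebra_simps)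

lemma Vset_diff_comb: "x \<in> Vset \<Longrightarrow> (\<And>p. p \<in> set L \<Longrightarrow> snd p \<in> Vset) \<Longrightarrow> diff_comb x L \<in> Vset"
  by (induction L) (auto simp: diff_comb_Nil diff_comb_Cons Vset_zero Vset_add Vset_scale Vset_diff)

lemma linear_V_diff_comb:
  assumes "linear_V f" "x \<in> Vset" "\<And>p. p \<in> set L \<Longrightarrow> snd p \<in> Vset"
  shows "f (diff_comb x L) = (\<Sum>p\<leftarrow>L. real_of_rat (fst p) * (f x - f (snd p)))"
  using assms(3)
proof (induction L)
  case (Cons p L)
  then have "f (diff_comb x (p # L)) = f (\<lambda>i. fst p * (x i - snd p i)) + f (diff_comb x L)"
    unfolding diff_comb_Cons using assms
    by (intro linear_V_add Vset_scale Vset_diff Vset_diff_comb) auto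
  also have "f (\<lambda>i. fst p * (x i - snd p i)) = real_of_rat (fst p) * (f x - f (snd p))"
    using assms Cons by (subst linear_V_scale) (auto simp: Vset_diff linear_V_diff)
  finally show ?case using Cons by simp
qed (use assms in \<open>simp add: diff_comb_Nil linear_V_zero\<close>)

lemma real_of_rat_weight: "real_of_rat (weight L) = (\<Sum>p\<leftarrow>L. real_of_rat (fst p))"
  by (induction L) (auto simp: weight_def of_rat_add)

lemma weight_nonneg: "(\<And>p. p \<in> set L \<Longrightarrow> 0 \<le> fst p) \<Longrightarrow> 0 \<le> weight L"
  unfolding weight_def by (rule sum_list_nonneg) auto

section \<open>The DLD2P is equivalent to the diametral condition\<close>

context rational_seminorm
begin

text \<open>The functional is dominated by \<open>P z = (INF (u, s)\<in>T. \<mu> (z + u) - s)\<close>, which is sublinear because \<open>T\<close> is a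
  cone.\<close>
lemma cone_separation:
  assumes zero: "((\<lambda>i. 0), 0) \<in> T"
    and add: "\<And>u s v t. (u, s) \<in> T \<Longrightarrow> (v, t) \<in> T \<Longrightarrow> ((\<lambda>i. u i + v i), s + t) \<in> T"
    and scale: "\<And>u s q. (u, s) \<in> T \<Longrightarrow> 0 < q \<Longrightarrow> ((\<lambda>i. q * u i), real_of_rat q * s) \<in> T"
    and T: "\<And>u s. (u, s) \<in> T \<Longrightarrow> u \<in> Vset \<and> s \<le> \<mu> u"
  obtains f where "linear_V f" "\<And>x. x \<in> Vset \<Longrightarrow> \<bar>f x\<bar> \<le> \<mu> x" "\<And>u s. (u, s) \<in> T \<Longrightarrow> s \<le> f u"
proof -
  define \<phi> where "\<phi> k z = \<mu> (\<lambda>i. z i + fst k i) - snd k" for k :: "(nat \<Rightarrow> rat) \<times> real" and z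
  define P where "P z = (if z \<in> Vset then (INF k\<in>T. \<phi> k z) else 0)" for z
  have "sublinear_V P \<and> (\<forall>k\<in>T. \<forall>z\<in>Vset. P z \<le> \<phi> k z)"
    unfolding P_def
  proof (rule sublinear_V_INF)
    fix z assume z: "z \<in> Vset"
    \<comment> \<open>Here s <= \<open>\<mu>\<close> u <= \<open>\<mu>\<close> (z + u) +
      \<open>\<mu>\<close> z, so the infimum is finite.\<close>
    have "- \<mu> z \<le> \<phi> k z" if "k \<in> T" for k
    proof -
      obtain u s where k: "k = (u, s)" by fastforce
      have "\<mu> u \<le> \<mu> (\<lambda>i. z i + u i) + \<mu> z"
        using mu_le_diff[of u "\<lambda>i. z i + u i"] mu_scale[OF z, of "-1"] T[of u s] that z k
        by (simp add: Vset_add)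
      then show ?thesis using T[of u s] that k by (auto simp: \<phi>_def)
    qed
    then show "\<exists>b. \<forall>k\<in>T. b \<le> \<phi> k z" by blast
  next
    fix k l x y assume kl: "k \<in> T" "l \<in> T" and xy: "x \<in> Vset" "y \<in> Vset"
    obtain u s v t where "k = (u, s)" "l = (v, t)" by fastforce
    with kl xy T[of u s] T[of v t] show "\<exists>m\<in>T. \<phi> m (\<lambda>l. x l + y l) \<le> \<phi> k x + \<phi> l y"
      using mu_add[of "\<lambda>i. x i + u i" "\<lambda>i. y i + v i"] add[of u s v t]
      by (intro bexI[of _ "((\<lambda>i. u i + v i), s + t)"]) (auto simp: \<phi>_def Vset_add algebra_simps)
  next
    fix k x and q :: rat assume k: "k \<in> T" and q: "0 < q" and x: "x \<in> Vset"
    obtain u s where "k = (u, s)" by fastforce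
    with k q x T[of u s] show "\<exists>m\<in>T. \<phi> m (\<lambda>l. q * x l) \<le> real_of_rat q * \<phi> k x"
      using mu_scale[of "\<lambda>i. x i + u i" q] scale[of u s q]
      by (intro bexI[of _ "((\<lambda>i. q * u i), real_of_rat q * s)"]) (auto simp: \<phi>_def Vset_add algebra_simps)
  qed (use zero in auto)
  then have P: "sublinear_V P" "\<And>k z. k \<in> T \<Longrightarrow> z \<in> Vset \<Longrightarrow> P z \<le> \<phi> k z"
    by auto
  obtain f where f: "linear_V f" "\<And>x. x \<in> Vset \<Longrightarrow> f x \<le> P x"
    using Hahn_Banach_V[OF P(1)] by blast
  have le: "f x \<le> \<mu> x" if "x \<in> Vset" for x
    using f(2)[OF that] P(2)[OF zero that] by (simp add: \<phi>_def)
  show ?thesis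
  proof
    show "\<bar>f x\<bar> \<le> \<mu> x" if "x \<in> Vset" for x
      using le[OF that] le[OF Vset_uminus[OF that]] mu_scale[OF that, of "-1"]
      by (simp add: linear_V_uminus[OF f(1) that])
    show "s \<le> f u" if us: "(u, s) \<in> T" for u s
    proof -
      have u: "u \<in> Vset" using T[OF us] by blast
      \<comment> \<open>At z = -u the pair (u, s) contributes \<open>\<mu>\<close> 0 - s = -s to the
        infimum.\<close>
      then have "f (\<lambda>i. - u i) \<le> - s"
        using f(2)[OF Vset_uminus[OF u]] P(2)[OF us Vset_uminus[OF u]] by (simp add: \<phi>_def mu_zero)
      then show ?thesis by (simp add: linear_V_uminus[OF f(1) u])
    qed
  qed (fact f(1))
qed

text \<open>The values at unit vectors determine a real-linear extension to \<open>c00\<close>; its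
  bound passes from rational approximants to the limit, and then to the completion.\<close>

lemma Xfunctional_of_linear_V:
  assumes f: "linear_V f" and bound: "\<And>x. x \<in> Vset \<Longrightarrow> \<bar>f x\<bar> \<le> \<mu> x"
  obtains F where "\<And>c d. c \<in> Xcar \<mu> \<Longrightarrow> d \<in> Xcar \<mu> \<Longrightarrow> F (Xadd \<mu> c d) = F c + F d"
    "\<And>a c. c \<in> Xcar \<mu> \<Longrightarrow> F (Xscale \<mu> a c) = a * F c"
    "\<And>c. c \<in> Xcar \<mu> \<Longrightarrow> \<bar>F c\<bar> \<le> Xnorm \<mu> c"
    "\<And>v. v \<in> Vset \<Longrightarrow> F (Xembed \<mu> (real_vec v)) = f v"
proof -
  define h where "h x = (\<Sum>i | x i \<noteq> 0. x i * f (unit_vec i))" for x :: "nat \<Rightarrow> real"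
  have h: "h x = (\<Sum>i\<in>S. x i * f (unit_vec i))" if "finite S" "\<And>i. i \<notin> S \<Longrightarrow> x i = 0" for x S
    unfolding h_def using that by (intro sum.mono_neutral_left) auto
  have hv: "h (real_vec v) = f v" if "v \<in> Vset" for v
    using that by (subst h[of "{i. v i \<noteq> 0}"], simp_all add: Vset_def real_vec_def)
      (subst linear_V_eq_sum[OF f, of "{i. v i \<noteq> 0}"], simp_all add: real_vec_def)
  obtain F where F: "\<And>c d. c \<in> Xcar \<mu> \<Longrightarrow> d \<in> Xcar \<mu> \<Longrightarrow> F (Xadd \<mu> c d) = F c + F d"
    "\<And>a c. c \<in> Xcar \<mu> \<Longrightarrow> F (Xscale \<mu> a c) = a * F c"
    "\<And>c. c \<in> Xcar \<mu> \<Longrightarrow> \<bar>F c\<bar> \<le> Xnorm \<mu> c"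
    "\<And>x. x \<in> c00 \<Longrightarrow> F (Xembed \<mu> x) = h x"
  proof (rule Xfunctional_extension)
    fix x y assume xy: "x \<in> c00" "y \<in> c00"
    let ?S = "{i. x i \<noteq> 0} \<union> {i. y i \<noteq> 0}"
    have "finite ?S" using xy by (auto simp: c00_def)
    then show "h (\<lambda>i. x i + y i) = h x + h y"
      by (subst (1 2 3) h[of ?S]) (auto simp: sum.distrib algebra_simps)
  next
    fix a and x assume "x \<in> c00"
    then show "h (\<lambda>i. a * x i) = a * h x"
      by (subst (1 2) h[of "{i. x i \<noteq> 0}"]) (auto simp: c00_def sum_distrib_left algebra_simps)
  next
    fix x assume x: "x \<in> c00"
    let ?r = "\<lambda>n. rat_approx n x"
    have "(\<lambda>n. h (real_vec (?r n))) \<longlonglongrightarrow> h x"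
    proof -
      have "h (real_vec (?r n)) = (\<Sum>i | x i \<noteq> 0. real_vec (?r n) i * f (unit_vec i))" for n
        using x by (intro h) (auto simp: c00_def real_vec_def rat_approx_eq_0)
      then show ?thesis
        unfolding h_def[of x] by (simp only:) (intro tendsto_sum tendsto_mult tendsto_const rat_approx_tendsto)
    qed
    moreover have "\<bar>h (real_vec (?r n))\<bar> \<le> g (real_vec (?r n))" for n
      using bound[OF Vset_rat_approx[OF x]] Vset_rat_approx[OF x] by (simp add: hv mu_bar_real_vec)
    ultimately show "\<bar>h x\<bar> \<le> g x"
      using LIMSEQ_le[OF tendsto_rabs seminorm_c00_tendsto_rat_approx[OF seminorm_c00_mu_bar x]]
      by blast
  qed blast
  show ?thesis
    by (rule that[of F]) (auto simp: F hv c00_real_vec)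
qed

text \<open>The constant C makes the set under \<open>Sup\<close> bounded, so that its supremum 1
  really bounds F on the ball. Vectors of norm 0 cannot be normalised and are handled by C
  itself.\<close>

lemma dual_sphere_bound:
  assumes F: "dual_sphere (Xcar \<mu>) (Xadd \<mu>) (Xscale \<mu>) (Xnorm \<mu>) F" and c: "c \<in> Xcar \<mu>"
  shows "\<bar>F c\<bar> \<le> Xnorm \<mu> c"
proof -
  let ?A = "{\<bar>F x\<bar> | x. x \<in> Xcar \<mu> \<and> Xnorm \<mu> x \<le> 1}"
  obtain C where C: "\<And>x. x \<in> Xcar \<mu> \<Longrightarrow> \<bar>F x\<bar> \<le> C * Xnorm \<mu> x"
    and sup: "Sup ?A = 1" and scale: "\<And>a x. x \<in> Xcar \<mu> \<Longrightarrow> F (Xscale \<mu> a x) = a * F x"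
    using F unfolding dual_sphere_def by blast
  have "bdd_above ?A"
  proof (rule bdd_aboveI[of _ "\<bar>C\<bar>"])
    fix r assume "r \<in> ?A"
    then obtain x where x: "x \<in> Xcar \<mu>" "Xnorm \<mu> x \<le> 1" "r = \<bar>F x\<bar>" by blast
    have "C * Xnorm \<mu> x \<le> \<bar>C\<bar> * 1"
      using x Xnorm_nonneg[OF x(1)] by (intro mult_mono) auto
    then show "r \<le> \<bar>C\<bar>" using C[OF x(1)] x(3) by simp
  qed
  then have le1: "\<bar>F x\<bar> \<le> 1" if "x \<in> Xcar \<mu>" "Xnorm \<mu> x \<le> 1" for x
    using cSup_upper[of "\<bar>F x\<bar>" ?A] sup that by auto
  show ?thesis
  proof (cases "Xnorm \<mu> c = 0")
    case True
    then show ?thesis using C[OF c] by simp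
  next
    case False
    then have pos: "0 < Xnorm \<mu> c" using Xnorm_nonneg[OF c] by simp
    have "\<bar>F (Xscale \<mu> (inverse (Xnorm \<mu> c)) c)\<bar> \<le> 1"
      using pos c by (intro le1 Xscale_closed) (auto simp: Xnorm_Xscale)
    then show ?thesis using pos c by (simp add: scale abs_mult field_simps)
  qed
qed

text \<open>The vector \<open>y\<close> provided by \<open>diametral_at\<close> has norm slightly above \<open>1\<close> and is rescaled into the ball.\<close>
lemma has_DLD2P_if_diametral:
  assumes D: "\<And>x e. x \<in> Vset \<Longrightarrow> 0 < e \<Longrightarrow> diametral_at \<mu> x e"
  shows "has_DLD2P \<mu>"
  unfolding has_DLD2P_def DLD2P_def
proof (intro allI impI ballI)
  fix \<epsilon> F \<alpha> c
  assume \<epsilon>: "0 < (\<epsilon>::real)"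
    and F\<alpha>: "dual_sphere (Xcar \<mu>) (Xadd \<mu>) (Xscale \<mu>) (Xnorm \<mu>) F \<and> 0 < \<alpha>"
    and "c \<in> slice (Xcar \<mu>) (Xnorm \<mu>) F \<alpha>" and N1: "Xnorm \<mu> c = 1"
  then have c: "c \<in> Xcar \<mu>" and Fc: "F c > 1 - \<alpha>" by (auto simp: slice_def)
  note bound = dual_sphere_bound[OF conjunct1[OF F\<alpha>]]
  have Fadd: "F (Xadd \<mu> c d) = F c + F d" if "c \<in> Xcar \<mu>" "d \<in> Xcar \<mu>" for c d
    using F\<alpha> that by (auto simp: dual_sphere_def)
  have Fscale: "F (Xscale \<mu> a c) = a * F c" if "c \<in> Xcar \<mu>" for a c
    using F\<alpha> that by (auto simp: dual_sphere_def)
  have Fdist: "\<bar>F c - F d\<bar> \<le> Xdist \<mu> c d" if "c \<in> Xcar \<mu>" "d \<in> Xcar \<mu>" for c d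
    using bound[OF Xadd_closed[OF that(1) Xscale_closed[OF that(2), of "-1"]]] that
    by (simp add: Xdist_def Fadd Fscale Xscale_closed)
  \<comment> \<open>F loses e from c to x, e from x to y and 2e by rescaling y, in total 4e. The
    distance loses 2e from \<open>\<mu>\<close> x > 1 - e, e from \<open>diametral_set\<close>, e
    from c to x and 2e by rescaling, in total 6e.\<close>
  define e where "e = min ((F c - (1 - \<alpha>)) / 4) (\<epsilon> / 6)"
  have e: "0 < e" "4 * e \<le> F c - (1 - \<alpha>)" "6 * e \<le> \<epsilon>"
    unfolding e_def using Fc \<epsilon> by (auto simp: min_def)
  let ?i = "\<lambda>v. Xembed \<mu> (real_vec v)"
  have ic: "?i v \<in> Xcar \<mu>" if "v \<in> Vset" for v using that by (simp add: Xembed_closed c00_real_vec)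
  have inorm: "Xnorm \<mu> (?i v) = \<mu> v" if "v \<in> Vset" for v
    using that by (simp add: Xnorm_Xembed c00_real_vec mu_bar_real_vec)
  have idist: "Xdist \<mu> (?i v) (?i w) = \<mu> (\<lambda>i. v i - w i)" if "v \<in> Vset" "w \<in> Vset" for v w
    using that mu_bar_real_vec[OF Vset_diff[OF that]]
    by (simp add: Xdist_Xembed c00_real_vec real_vec_diff)
  define h where "h v = F (?i v)" for v
  have h: "linear_V h"
    unfolding linear_V_def h_def
    by (auto simp: real_vec_add real_vec_scale c00_real_vec ic Fadd Fscale
        simp flip: Xadd_Xembed Xscale_Xembed)
  have hb: "\<bar>h v\<bar> \<le> \<mu> v" if "v \<in> Vset" for v
    using bound[OF ic[OF that]] inorm[OF that] by (simp add: h_def)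
  obtain x where x: "x \<in> Vset" "Xdist \<mu> c (?i x) < e"
    using Xembed_dense[OF c e(1)] .
  obtain L where L: "\<And>p. p \<in> set L \<Longrightarrow> 0 \<le> fst p \<and> snd p \<in> diametral_set \<mu> x e" "0 < weight L"
    "\<mu> (diff_comb x L) < e * real_of_rat (weight L)"
    using D[OF x(1) e(1)] by (auto simp: diametral_at_def)
  have LV: "snd p \<in> Vset" if "p \<in> set L" for p using L(1)[OF that] by (simp add: diametral_set_def)
  \<comment> \<open>If h dropped by at least e towards every member, the weighted drops would reach
    e times the total weight, against the bound on \<open>diff_comb x L\<close>.\<close>
  have "\<exists>p\<in>set L. h x - h (snd p) < e"
  proof (rule ccontr)
    assume no: "\<not> ?thesis"
    have "e * real_of_rat (weight L) = (\<Sum>p\<leftarrow>L. real_of_rat (fst p) * e)"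
      by (simp add: real_of_rat_weight sum_list_const_mult sum_list_mult_const)
    also have "\<dots> \<le> (\<Sum>p\<leftarrow>L. real_of_rat (fst p) * (h x - h (snd p)))"
      using no L(1) by (intro sum_list_mono mult_left_mono) (auto simp: not_less)
    also have "\<dots> = h (diff_comb x L)"
      using linear_V_diff_comb[OF h x(1) LV] by simp
    also have "\<dots> \<le> \<mu> (diff_comb x L)"
      using hb[OF Vset_diff_comb[OF x(1), of L]] LV by simp
    finally show False using L(3) by simp
  qed
  then obtain y where y: "y \<in> diametral_set \<mu> x e" and hy: "h x - h y < e"
    using L(1) by blast
  have yV: "y \<in> Vset" and ny: "\<mu> y < \<mu> x + e" and dy: "2 * \<mu> x - e < \<mu> (\<lambda>i. x i - y i)"
    using y by (auto simp: diametral_set_def)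
  have nx: "\<bar>1 - \<mu> x\<bar> < e"
    using Xnorm_diff_le[OF c ic[OF x(1)]] x N1 by (simp add: inorm)
  have Fx: "\<bar>F c - h x\<bar> < e"
    using Fdist[OF c ic[OF x(1)]] x by (simp add: h_def)
  \<comment> \<open>Since \<open>\<mu>\<close> y < \<open>\<mu>\<close> x + e < 1 + 2e, this factor
    brings y into the ball while moving it by at most 2e.\<close>
  define a where "a = inverse (1 + 2 * e)"
  have a: "0 < a" "a < 1" "1 - a = 2 * e * a" using e by (auto simp: a_def field_simps)
  have an: "a * \<mu> y \<le> 1" using ny nx e by (simp add: a_def field_simps)
  let ?z = "Xscale \<mu> a (?i y)"
  have z: "?z \<in> Xcar \<mu>" by (intro Xscale_closed ic yV)
  have zn: "Xnorm \<mu> ?z \<le> 1" using an a by (simp add: Xnorm_Xscale ic yV inorm)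
  have yz: "Xdist \<mu> (?i y) ?z \<le> 2 * e"
  proof -
    have "Xdist \<mu> (?i y) ?z = 2 * e * (a * \<mu> y)"
      using a e by (simp add: Xdist_Xscale_self ic yV inorm abs_of_pos)
    also have "\<dots> \<le> 2 * e * 1" using an e by (intro mult_left_mono) auto
    finally show ?thesis by simp
  qed
  have "F ?z > 1 - \<alpha>"
    using Fdist[OF ic[OF yV] z] yz hy Fx e by (simp add: h_def)
  moreover have "Xdist \<mu> c ?z > 2 - \<epsilon>"
  proof -
    have "Xdist \<mu> (?i x) (?i y) \<le> Xdist \<mu> (?i x) c + (Xdist \<mu> c ?z + Xdist \<mu> ?z (?i y))"
      using Xdist_triangle[OF ic[OF x(1)] c ic[OF yV]] Xdist_triangle[OF c z ic[OF yV]] by simp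
    then show ?thesis
      using x(2) yz dy nx e Xdist_commute[OF c ic[OF x(1)]] Xdist_commute[OF z ic[OF yV]]
      by (simp add: idist x yV)
  qed
  ultimately show "\<exists>y\<in>slice (Xcar \<mu>) (Xnorm \<mu>) F \<alpha>. 2 - \<epsilon> < Xnorm \<mu> (Xadd \<mu> c (Xscale \<mu> (- 1) y))"
    using z zn by (intro bexI[of _ ?z]) (auto simp: slice_def Xdist_def)
qed

text \<open>By contraposition: cone separation gives f that drops by at least e from x to every
  diametral vector. A slice containing x / \<open>\<mu>\<close> x is cut so thin that, after scaling
  back, f drops by less than e/2 on it. The far point supplied there by the DLD2P, approximated by a
  rational vector, is diametral with a drop below e.\<close>

lemma diametral_if_has_DLD2P:
  assumes D: "has_DLD2P \<mu>" and x: "x \<in> Vset" and e: "0 < e"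
  shows "diametral_at \<mu> x e"
proof (rule ccontr)
  assume not: "\<not> diametral_at \<mu> x e"
  let ?G = "\<lambda>L. \<forall>p\<in>set L. 0 \<le> fst p \<and> snd p \<in> diametral_set \<mu> x e"
  have LV: "diff_comb x L \<in> Vset" if "?G L" for L
    using that by (intro Vset_diff_comb x) (auto simp: diametral_set_def)
  define T where "T = {(diff_comb x L, e * real_of_rat (weight L)) | L. ?G L}"
  have TI: "(diff_comb x L, e * real_of_rat (weight L)) \<in> T" if "?G L" for L
    using that by (auto simp: T_def)
  obtain f where f: "linear_V f" "\<And>v. v \<in> Vset \<Longrightarrow> \<bar>f v\<bar> \<le> \<mu> v"
    and fT: "\<And>u s. (u, s) \<in> T \<Longrightarrow> s \<le> f u"
  proof (rule cone_separation[of T])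
    show "((\<lambda>i. 0), 0) \<in> T"
      using TI[of "[]"] by (simp add: diff_comb_Nil weight_def)
  next
    fix u s v t assume "(u, s) \<in> T" "(v, t) \<in> T"
    then obtain L M where "?G L" "?G M" "u = diff_comb x L" "s = e * real_of_rat (weight L)"
      "v = diff_comb x M" "t = e * real_of_rat (weight M)" by (auto simp: T_def)
    then show "((\<lambda>i. u i + v i), s + t) \<in> T"
      using TI[of "L @ M"] by (simp add: ball_Un diff_comb_append weight_def of_rat_add distrib_left)
  next
    fix u s q assume "(u, s) \<in> T" and q: "0 < (q::rat)"
    then obtain L where "?G L" "u = diff_comb x L" "s = e * real_of_rat (weight L)"
      by (auto simp: T_def)
    then show "((\<lambda>i. q * u i), real_of_rat q * s) \<in> T"
      using TI[of "map (map_prod ((*) q) id) L"] q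
      by (auto simp: diff_comb_scale weight_scale of_rat_mult mult_ac)
  next
    fix u s assume "(u, s) \<in> T"
    then obtain L where L: "?G L" "u = diff_comb x L" "s = e * real_of_rat (weight L)"
      by (auto simp: T_def)
    \<comment> \<open>For total weight 0 the claim is nonnegativity of \<open>\<mu>\<close>; for
      positive weight it is the failure of \<open>diametral_at\<close>.\<close>
    have "weight L = 0 \<or> 0 < weight L" using L(1) weight_nonneg[of L] by fastforce
    then have "s \<le> \<mu> u"
      using L not LV[OF L(1)] by (auto simp: diametral_at_def mu_nonneg not_less)
    then show "u \<in> Vset \<and> s \<le> \<mu> u" using L LV by simp
  qed blast
  have sep: "e \<le> f x - f y" if y: "y \<in> diametral_set \<mu> x e" for y
  proof -
    have "diff_comb x [(1, y)] = (\<lambda>i. x i - y i)" by (simp add: diff_comb_def fun_eq_iff)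
    then show ?thesis
      using fT[OF TI[of "[(1, y)]"]] y linear_V_diff[OF f(1) x, of y]
      by (auto simp: weight_def diametral_set_def)
  qed
  \<comment> \<open>Otherwise x itself would be diametral, with drop 0. This bound permits division
    by \<open>\<mu>\<close> x.\<close>
  have mx: "e / 2 \<le> \<mu> x"
  proof (rule ccontr)
    assume "\<not> ?thesis"
    then have "x \<in> diametral_set \<mu> x e" using x e by (simp add: diametral_set_def mu_zero)
    from sep[OF this] e show False by simp
  qed
  define m where "m = \<mu> x"
  have m: "0 < m" using mx e by (simp add: m_def)
  \<comment> \<open>The vector -x is always diametral; its drop 2 f(x) shows that f does not vanish
    at x, so the norm of F is positive.\<close>
  have "(\<lambda>i. - x i) \<in> diametral_set \<mu> x e"
    using mu_scale[OF x, of "-1"] mu_scale[OF x, of 2] x e by (simp add: diametral_set_def Vset_uminus)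
  from sep[OF this] have fx: "e \<le> 2 * f x"
    using linear_V_uminus[OF f(1) x] by simp
  obtain F where Fadd: "\<And>c d. c \<in> Xcar \<mu> \<Longrightarrow> d \<in> Xcar \<mu> \<Longrightarrow> F (Xadd \<mu> c d) = F c + F d"
    and Fscale: "\<And>a c. c \<in> Xcar \<mu> \<Longrightarrow> F (Xscale \<mu> a c) = a * F c"
    and Fb: "\<And>c. c \<in> Xcar \<mu> \<Longrightarrow> \<bar>F c\<bar> \<le> Xnorm \<mu> c"
    and Fv: "\<And>v. v \<in> Vset \<Longrightarrow> F (Xembed \<mu> (real_vec v)) = f v"
    using Xfunctional_of_linear_V[OF f] by blast
  have Fdist: "\<bar>F c - F d\<bar> \<le> Xdist \<mu> c d" if "c \<in> Xcar \<mu>" "d \<in> Xcar \<mu>" for c d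
    using Fb[OF Xadd_closed[OF that(1) Xscale_closed[OF that(2), of "-1"]]] that
    by (simp add: Xdist_def Fadd Fscale Xscale_closed)
  let ?i = "\<lambda>v. Xembed \<mu> (real_vec v)"
  have ic: "?i v \<in> Xcar \<mu>" if "v \<in> Vset" for v using that by (simp add: Xembed_closed c00_real_vec)
  have inorm: "Xnorm \<mu> (?i v) = \<mu> v" if "v \<in> Vset" for v
    using that by (simp add: Xnorm_Xembed c00_real_vec mu_bar_real_vec)
  have idist: "Xdist \<mu> (?i v) (?i w) = \<mu> (\<lambda>i. v i - w i)" if "v \<in> Vset" "w \<in> Vset" for v w
    using that mu_bar_real_vec[OF Vset_diff[OF that]]
    by (simp add: Xdist_Xembed c00_real_vec real_vec_diff)
  define A where "A = {\<bar>F c\<bar> | c. c \<in> Xcar \<mu> \<and> Xnorm \<mu> c \<le> 1}"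
  \<comment> \<open>The norm of F; it may be below 1, so F is divided by it to reach the dual
    sphere.\<close>
  define \<kappa> where "\<kappa> = Sup A"
  define c where "c = Xscale \<mu> (inverse m) (?i x)"
  have c: "c \<in> Xcar \<mu>" unfolding c_def by (intro Xscale_closed ic x)
  have nc: "Xnorm \<mu> c = 1" using m by (simp add: c_def Xnorm_Xscale ic x inorm m_def)
  have Fc: "F c = f x / m" by (simp add: c_def Fscale ic x Fv field_simps)
  have bddA: "bdd_above A"
    using Fb by (intro bdd_aboveI[of _ 1]) (force simp: A_def)
  have A\<kappa>: "\<bar>F d\<bar> \<le> \<kappa>" if "d \<in> Xcar \<mu>" "Xnorm \<mu> d \<le> 1" for d
    unfolding \<kappa>_def by (rule cSup_upper[OF _ bddA]) (use that in \<open>auto simp: A_def\<close>)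
  have Fc\<kappa>: "f x / m \<le> \<kappa>" using A\<kappa>[OF c] nc Fc by (simp del: abs_divide)
  moreover have "0 < f x / m" using fx m e by simp
  ultimately have \<kappa>: "0 < \<kappa>" by linarith
  define G where "G d = F d / \<kappa>" for d
  have "{\<bar>G d\<bar> | d. d \<in> Xcar \<mu> \<and> Xnorm \<mu> d \<le> 1} = (\<lambda>r. inverse \<kappa> * r) ` A"
    using \<kappa> by (auto simp: A_def G_def image_iff field_simps)
  moreover have "Sup ((\<lambda>r. inverse \<kappa> * r) ` A) = inverse \<kappa> * Sup A"
  proof (rule continuous_at_Sup_mono[symmetric])
    show "mono (\<lambda>r. inverse \<kappa> * r)" using \<kappa> by (auto intro!: monoI)
    show "A \<noteq> {}" using c nc by (auto simp: A_def)
  qed (use bddA in \<open>auto intro!: continuous_mult_left continuous_ident\<close>)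
  ultimately have "Sup {\<bar>G d\<bar> | d. d \<in> Xcar \<mu> \<and> Xnorm \<mu> d \<le> 1} = 1"
    using \<kappa> by (simp add: \<kappa>_def)
  moreover have "\<forall>d\<in>Xcar \<mu>. \<bar>G d\<bar> \<le> inverse \<kappa> * Xnorm \<mu> d"
    using \<kappa> Fb by (auto simp: G_def field_simps)
  ultimately have G: "dual_sphere (Xcar \<mu>) (Xadd \<mu>) (Xscale \<mu>) (Xnorm \<mu>) G"
    unfolding dual_sphere_def by (auto simp: G_def Fadd Fscale add_divide_distrib)
  \<comment> \<open>Scaled by m, the slice condition G > 1 - \<open>\<alpha>\<close> reads F > f x -
    e/2.\<close>
  define \<alpha> where "\<alpha> = 1 - (f x - e / 2) / (\<kappa> * m)"
  have \<alpha>: "1 - \<alpha> < G c" "0 < \<alpha>"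
  proof -
    have "(f x - e / 2) / (\<kappa> * m) < f x / (\<kappa> * m)"
      using \<kappa> m e by (intro divide_strict_right_mono mult_pos_pos) auto
    then show "1 - \<alpha> < G c" by (simp add: \<alpha>_def G_def Fc mult.commute)
    also have "G c \<le> 1" unfolding G_def Fc using Fc\<kappa> \<kappa> by (simp add: divide_le_eq_1 del: divide_divide_eq_left)
    finally show "0 < \<alpha>" by simp
  qed
  have "c \<in> slice (Xcar \<mu>) (Xnorm \<mu>) G \<alpha>" using c nc \<alpha> by (simp add: slice_def)
  \<comment> \<open>A loss of e/(2m) in distance becomes e/2 after scaling by m.\<close>
  moreover have "0 < e / (2 * m)" using e m by simp
  ultimately obtain z where z: "z \<in> slice (Xcar \<mu>) (Xnorm \<mu>) G \<alpha>" "2 - e / (2 * m) < Xdist \<mu> c z"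
    using D G \<alpha>(2) nc unfolding has_DLD2P_def DLD2P_def Xdist_def by blast
  then have zX: "z \<in> Xcar \<mu>" and zn: "Xnorm \<mu> z \<le> 1" and Gz: "1 - \<alpha> < G z" by (auto simp: slice_def)
  let ?z = "Xscale \<mu> m z"
  have z': "?z \<in> Xcar \<mu>" by (rule Xscale_closed[OF zX])
  have n: "Xnorm \<mu> ?z \<le> m" using zn m by (simp add: Xnorm_Xscale zX)
  have Fz: "f x - e / 2 < F ?z"
  proof -
    have "f x - e / 2 < F z / \<kappa> * (\<kappa> * m)"
      using Gz \<kappa> m by (subst pos_divide_less_eq[symmetric]) (auto simp: \<alpha>_def G_def)
    then show ?thesis using \<kappa> by (simp add: Fscale zX mult.commute)
  qed
  have "Xscale \<mu> m c = ?i x"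
    using m x by (simp add: c_def Xscale_Xembed c00_real_vec c00_scale flip: mult.assoc)
  then have "Xdist \<mu> (?i x) ?z = m * Xdist \<mu> c z"
    using Xdist_Xscale[OF c zX, of m] m by simp
  moreover have "m * (2 - e / (2 * m)) < m * Xdist \<mu> c z"
    using z(2) m by (intro mult_strict_left_mono)
  ultimately have dz: "2 * m - e / 2 < Xdist \<mu> (?i x) ?z"
    using m by (simp add: algebra_simps)
  \<comment> \<open>The error e/4 together with the earlier loss e/2 stays below e, both in distance
    and in f.\<close>
  obtain y where y: "y \<in> Vset" "Xdist \<mu> ?z (?i y) < e / 4"
    using Xembed_dense[OF z', of "e / 4"] e by auto
  have "\<mu> y < \<mu> x + e"
    using Xnorm_diff_le[OF z' ic[OF y(1)]] y(2) n e inorm[OF y(1)] by (simp add: m_def)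
  moreover have "2 * \<mu> x - e < \<mu> (\<lambda>i. x i - y i)"
    using Xdist_triangle[OF ic[OF x] ic[OF y(1)] z'] Xdist_commute[OF z' ic[OF y(1)]] dz y(2) e
    by (simp add: m_def idist x y(1))
  ultimately have "y \<in> diametral_set \<mu> x e" using y(1) by (simp add: diametral_set_def)
  from sep[OF this] show False
    using Fdist[OF z' ic[OF y(1)]] y(2) Fz e Fv[OF y(1)] by simp
qed

lemma diametral_at_mono:
  assumes "diametral_at \<mu> x d" "d \<le> e"
  shows "diametral_at \<mu> x e"
proof -
  obtain L where L: "\<forall>p\<in>set L. 0 \<le> fst p \<and> snd p \<in> diametral_set \<mu> x d" "0 < weight L"
    "\<mu> (diff_comb x L) < d * real_of_rat (weight L)"
    using assms(1) by (auto simp: diametral_at_def)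
  have "d * real_of_rat (weight L) \<le> e * real_of_rat (weight L)"
    using assms(2) L(2) by (intro mult_right_mono) auto
  then have "\<mu> (diff_comb x L) < e * real_of_rat (weight L)"
    using L(3) by linarith
  moreover have "diametral_set \<mu> x d \<subseteq> diametral_set \<mu> x e"
    using assms(2) by (auto simp: diametral_set_def)
  ultimately show ?thesis
    using L unfolding diametral_at_def by blast
qed

theorem has_DLD2P_iff_diametral:
  "has_DLD2P \<mu> \<longleftrightarrow> (\<forall>x\<in>Vset. \<forall>n. diametral_at \<mu> x (inverse (real (Suc n))))"
proof
  assume "\<forall>x\<in>Vset. \<forall>n. diametral_at \<mu> x (inverse (real (Suc n)))"
  moreover have "\<exists>n. inverse (real (Suc n)) \<le> e" if "0 < e" for e
    using reals_Archimedean[OF that] less_imp_le by blast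
  ultimately show "has_DLD2P \<mu>"
    using diametral_at_mono by (intro has_DLD2P_if_diametral) blast
qed (use diametral_if_has_DLD2P in \<open>simp del: of_nat_Suc\<close>)

end

subsection \<open>The Gdelta property\<close>

lemma countable_Vset: "countable Vset"
proof -
  have "Vset \<subseteq> range (\<lambda>xs i. if i < length xs then xs ! i else (0::rat))"
  proof
    fix v assume "v \<in> Vset"
    then obtain n where n: "\<And>i. v i \<noteq> 0 \<Longrightarrow> i < n"
      using finite_nat_set_iff_bounded by (auto simp: Vset_def)
    then have "v = (\<lambda>i. if i < length (map v [0..<n]) then map v [0..<n] ! i else 0)"
      by (auto simp: fun_eq_iff)
    then show "v \<in> range (\<lambda>xs i. if i < length xs then xs ! i else (0::rat))" by blast
  qed
  then show ?thesis by (rule countable_subset) simp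
qed

lemma continuous_map_RV_apply: "v \<in> Vset \<Longrightarrow> continuous_map RV euclideanreal (\<lambda>\<mu>. \<mu> v)"
  unfolding RV_def by (rule continuous_map_product_projection)

lemma openin_continuous_map_less:
  fixes f g :: "'a \<Rightarrow> real"
  assumes "continuous_map X euclideanreal f" "continuous_map X euclideanreal g"
  shows "openin X {x \<in> topspace X. f x < g x}"
  using openin_continuous_map_preimage[OF continuous_map_diff[OF assms], of "{..<0}"]
  by simp

lemma openin_diametral_set:
  assumes "x \<in> Vset" "y \<in> Vset"
  shows "openin RV {\<mu> \<in> topspace RV. y \<in> diametral_set \<mu> x e}"
proof -
  have "openin RV ({\<mu> \<in> topspace RV. \<mu> y < \<mu> x + e} \<inter>
      {\<mu> \<in> topspace RV. 2 * \<mu> x - e < \<mu> (\<lambda>i. x i - y i)})"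
    using assms
    by (intro openin_Int openin_continuous_map_less continuous_map_add continuous_map_diff
        continuous_map_real_mult continuous_map_RV_apply Vset_diff) auto
  moreover have "{\<mu> \<in> topspace RV. y \<in> diametral_set \<mu> x e} = {\<mu> \<in> topspace RV. \<mu> y < \<mu> x + e} \<inter>
      {\<mu> \<in> topspace RV. 2 * \<mu> x - e < \<mu> (\<lambda>i. x i - y i)}"
    using assms by (auto simp: diametral_set_def)
  ultimately show ?thesis by simp
qed

text \<open>Conditions on the list that do not involve \<open>\<mu>\<close> go into the index set of
  a union; for each list finitely many strict inequalities between continuous functions of
  \<open>\<mu>\<close> remain.\<close>

lemma openin_diametral_at:
  assumes x: "x \<in> Vset"
  shows "openin RV {\<mu> \<in> topspace RV. diametral_at \<mu> x e}"
proof -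
  define A where "A L = {\<mu> \<in> topspace RV. (\<forall>p\<in>set L. snd p \<in> diametral_set \<mu> x e) \<and>
    \<mu> (diff_comb x L) < e * real_of_rat (weight L)}" for L
  define \<L> where "\<L> = {L. (\<forall>p\<in>set L. 0 \<le> fst p \<and> snd p \<in> Vset) \<and> 0 < weight L}"
  have "openin RV (A L)" if "L \<in> \<L>" for L
  proof -
    have fin: "openin RV {\<mu> \<in> topspace RV. \<forall>p\<in>set M. snd p \<in> diametral_set \<mu> x e}"
      if "set M \<subseteq> set L" for M
      using that
    proof (induction M)
      case (Cons p M)
      then have "openin RV ({\<mu> \<in> topspace RV. snd p \<in> diametral_set \<mu> x e} \<inter>
          {\<mu> \<in> topspace RV. \<forall>p\<in>set M. snd p \<in> diametral_set \<mu> x e})"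
        using \<open>L \<in> \<L>\<close> x by (intro openin_Int openin_diametral_set) (auto simp: \<L>_def)
      then show ?case by (rule back_subst[of "openin RV"]) auto
    qed simp
    have "diff_comb x L \<in> Vset"
      using that x by (intro Vset_diff_comb) (auto simp: \<L>_def)
    then have "openin RV ({\<mu> \<in> topspace RV. \<forall>p\<in>set L. snd p \<in> diametral_set \<mu> x e} \<inter>
        {\<mu> \<in> topspace RV. \<mu> (diff_comb x L) < e * real_of_rat (weight L)})"
      by (intro openin_Int openin_continuous_map_less fin continuous_map_RV_apply) auto
    then show ?thesis by (rule back_subst[of "openin RV"]) (auto simp: A_def)
  qed
  then have "openin RV (\<Union>L\<in>\<L>. A L)" by blast
  moreover have "{\<mu> \<in> topspace RV. diametral_at \<mu> x e} = (\<Union>L\<in>\<L>. A L)"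
    by (auto simp: diametral_at_def A_def \<L>_def diametral_set_def)
  ultimately show ?thesis by simp
qed

text \<open>The diametral conditions define a Gdelta set in all of \<open>RV\<close>; their
  equivalence with the DLD2P is invoked for seminorms, that is, on the trace in
  \<open>Pcal\<close>.\<close>

lemma gdelta_in_DLD2P:
  assumes "I \<subseteq> Pcal"
  shows "gdelta_in (subtopology RV I) {\<mu> \<in> I. has_DLD2P \<mu>}"
proof -
  define T where "T = (\<Inter>k\<in>Vset \<times> (UNIV :: nat set).
    {\<mu> \<in> topspace RV. diametral_at \<mu> (fst k) (inverse (real (Suc (snd k))))})"
  have "gdelta_in RV T"
    unfolding T_def using countable_Vset Vset_zero
    by (intro gdelta_in_Inter) (auto intro!: open_imp_gdelta_in openin_diametral_at simp del: of_nat_Suc)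
  moreover have "{\<mu> \<in> I. has_DLD2P \<mu>} = T \<inter> I"
  proof -
    have "\<mu> \<in> T \<longleftrightarrow> has_DLD2P \<mu>" if "\<mu> \<in> I" for \<mu>
    proof -
      have "\<mu> \<in> topspace RV" "rational_seminorm \<mu>"
        using assms that by (auto simp: Pcal_def rational_seminorm_def)
      then show ?thesis
        using Vset_zero by (auto simp: T_def rational_seminorm.has_DLD2P_iff_diametral simp del: of_nat_Suc)
    qed
    then show ?thesis by auto
  qed
  ultimately show ?thesis unfolding gdelta_in_subtopology by blast
qed

subsection \<open>Supremum norms on polynomials\<close>

definition poly_val :: "(nat \<Rightarrow> real) \<Rightarrow> real \<Rightarrow> real" where
  "poly_val x t = (\<Sum>i | x i \<noteq> 0. x i * t ^ i)"

definition sup_norm :: "real set \<Rightarrow> (nat \<Rightarrow> real) \<Rightarrow> real" where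
  "sup_norm K x = (if x \<in> c00 then (SUP t\<in>K. \<bar>poly_val x t\<bar>) else 0)"

text \<open>\<open>restrict\<close> makes it a point of the product space \<open>RV\<close>, whose
  elements are \<open>undefined\<close> off \<open>Vset\<close>.\<close>

definition sup_mu :: "real set \<Rightarrow> (nat \<Rightarrow> rat) \<Rightarrow> real" where
  "sup_mu K = restrict (\<lambda>v. sup_norm K (real_vec v)) Vset"

lemma poly_val_eq: "finite S \<Longrightarrow> (\<And>i. i \<notin> S \<Longrightarrow> x i = 0) \<Longrightarrow> poly_val x t = (\<Sum>i\<in>S. x i * t ^ i)"
  unfolding poly_val_def by (intro sum.mono_neutral_left) auto

lemma poly_val_add:
  assumes "x \<in> c00" "y \<in> c00"
  shows "poly_val (\<lambda>i. x i + y i) t = poly_val x t + poly_val y t"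
proof -
  let ?S = "{i. x i \<noteq> 0} \<union> {i. y i \<noteq> 0}"
  have "finite ?S" using assms by (auto simp: c00_def)
  then show ?thesis
    by (subst (1 2 3) poly_val_eq[of ?S]) (auto simp: sum.distrib algebra_simps)
qed

lemma poly_val_scale: "x \<in> c00 \<Longrightarrow> poly_val (\<lambda>i. a * x i) t = a * poly_val x t"
  by (subst (1 2) poly_val_eq[of "{i. x i \<noteq> 0}"]) (auto simp: c00_def sum_distrib_left algebra_simps)

lemma poly_val_diff: "x \<in> c00 \<Longrightarrow> y \<in> c00 \<Longrightarrow> poly_val (\<lambda>i. x i - y i) t = poly_val x t - poly_val y t"
  using poly_val_add[of x "\<lambda>i. -1 * y i" t] poly_val_scale[of y "-1" t] c00_scale[of y "-1"] by simp

lemma linear_V_poly_val: "linear_V (\<lambda>v. poly_val (real_vec v) t)"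
  by (auto simp: linear_V_def real_vec_add real_vec_scale poly_val_add poly_val_scale c00_real_vec)

lemma poly_val_bound:
  assumes "t \<in> {0..1}"
  shows "\<bar>poly_val x t\<bar> \<le> (\<Sum>i | x i \<noteq> 0. \<bar>x i\<bar>)"
  unfolding poly_val_def
  by (rule order_trans[OF sum_abs sum_mono])
    (use assms in \<open>auto simp: abs_mult power_abs intro!: mult_left_le power_le_one\<close>)

text \<open>On [0,1] the power t^i has Lipschitz constant i. The estimate transfers small movements
  of K to the sup norm.\<close>

lemma poly_val_Lipschitz:
  assumes "s \<in> {0..1}" "t \<in> {0..1}"
  shows "\<bar>poly_val x s - poly_val x t\<bar> \<le> (\<Sum>i | x i \<noteq> 0. \<bar>x i\<bar> * real i) * \<bar>s - t\<bar>"
proof -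
  have "\<bar>s ^ i - t ^ i\<bar> \<le> real i * \<bar>s - t\<bar>" for i
    using norm_power_diff[of s t i] assms by auto
  then have "\<bar>x i * s ^ i - x i * t ^ i\<bar> \<le> \<bar>x i\<bar> * real i * \<bar>s - t\<bar>" for i
    by (simp add: abs_mult mult.assoc mult_left_mono flip: right_diff_distrib)
  then show ?thesis
    unfolding poly_val_def sum_distrib_right sum_subtractf[symmetric]
    by (intro order_trans[OF sum_abs sum_mono])
qed

lemma continuous_poly_val: "continuous_on A (poly_val x)"
  unfolding poly_val_def by (intro continuous_intros)

lemma poly_val_eq_0_on_infinite:
  assumes x: "x \<in> c00" and K: "infinite K" "\<And>t. t \<in> K \<Longrightarrow> poly_val x t = 0"
  shows "x = (\<lambda>i. 0)"
proof -
  obtain n where n: "\<And>i. x i \<noteq> 0 \<Longrightarrow> i \<le> n"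
    using x finite_nat_set_iff_bounded_le by (auto simp: c00_def)
  then have "poly_val x t = (\<Sum>i\<le>n. x i * t ^ i)" for t
    by (intro poly_val_eq) auto
  then have "K \<subseteq> {t. (\<Sum>i\<le>n. x i * t ^ i) = 0}" using K(2) by auto
  then have "\<not> (\<exists>i\<le>n. x i \<noteq> 0)"
    using K(1) finite_subset unfolding polyfun_finite_roots[symmetric] by blast
  with n show ?thesis by auto
qed

section \<open>The sup norm over K as a coded space\<close>

locale sup_norm_space =
  fixes K :: "real set"
  assumes K_subset: "K \<subseteq> {0..1}" and K_ne: "K \<noteq> {}"
begin

lemma poly_val_le_sup_norm:
  assumes "x \<in> c00" "t \<in> K"
  shows "\<bar>poly_val x t\<bar> \<le> sup_norm K x"
proof -
  have "bdd_above ((\<lambda>t. \<bar>poly_val x t\<bar>) ` K)"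
    using K_subset poly_val_bound by (intro bdd_aboveI2) blast
  then show ?thesis using assms by (auto simp: sup_norm_def intro: cSUP_upper)
qed

lemma sup_norm_le:
  assumes "x \<in> c00" "\<And>t. t \<in> K \<Longrightarrow> \<bar>poly_val x t\<bar> \<le> b"
  shows "sup_norm K x \<le> b"
  using assms K_ne by (auto simp: sup_norm_def intro: cSUP_least)

lemma sup_norm_witness:
  assumes "x \<in> c00" "b < sup_norm K x"
  obtains t where "t \<in> K" "b < \<bar>poly_val x t\<bar>"
  using sup_norm_le[OF assms(1), of b] assms(2) by force

lemma seminorm_c00_sup_norm: "seminorm_c00 (sup_norm K)"
  unfolding seminorm_c00_def
proof (intro conjI ballI allI impI)
  fix x y assume xy: "x \<in> c00" "y \<in> c00"
  show "sup_norm K (\<lambda>i. x i + y i) \<le> sup_norm K x + sup_norm K y"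
  proof (rule sup_norm_le[OF c00_add[OF xy]])
    fix t assume "t \<in> K"
    with poly_val_le_sup_norm[OF xy(1)] poly_val_le_sup_norm[OF xy(2)]
    show "\<bar>poly_val (\<lambda>i. x i + y i) t\<bar> \<le> sup_norm K x + sup_norm K y"
      by (force simp: poly_val_add xy)
  qed
next
  fix a :: real and x assume x: "x \<in> c00"
  have le: "sup_norm K (\<lambda>i. a * x i) \<le> \<bar>a\<bar> * sup_norm K x" if "x \<in> c00" for a x
    using poly_val_le_sup_norm[OF that]
    by (intro sup_norm_le c00_scale that) (auto simp: poly_val_scale that abs_mult intro: mult_left_mono)
  show "sup_norm K (\<lambda>i. a * x i) = \<bar>a\<bar> * sup_norm K x"
  proof (cases "a = 0")
    case True
    obtain t where "t \<in> K" using K_ne by blast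
    then show ?thesis
      using le[OF x, of 0] poly_val_le_sup_norm[OF c00_zero, of t] True by simp
  next
    case False
    have "sup_norm K x \<le> \<bar>inverse a\<bar> * sup_norm K (\<lambda>i. a * x i)"
      using le[OF c00_scale[OF x], of "inverse a" a] False by (simp flip: mult.assoc)
    then have "\<bar>a\<bar> * sup_norm K x \<le> sup_norm K (\<lambda>i. a * x i)"
      using False by (simp add: field_simps)
    with le[OF x, of a] show ?thesis by simp
  qed
qed (simp add: sup_norm_def)

lemma seminorm_V_sup_mu: "seminorm_V (sup_mu K)"
  unfolding seminorm_V_def sup_mu_def
  by (auto simp: Vset_add Vset_scale real_vec_add real_vec_scale c00_real_vec
      seminorm_c00_add[OF seminorm_c00_sup_norm] seminorm_c00_scale[OF seminorm_c00_sup_norm])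

lemma sup_mu_in_Pcal: "sup_mu K \<in> Pcal"
  using seminorm_V_sup_mu by (simp add: Pcal_def RV_def sup_mu_def)

lemma rational_seminorm_sup_mu: "rational_seminorm (sup_mu K)"
  by (rule rational_seminorm.intro[OF seminorm_V_sup_mu])

lemma mu_bar_sup_mu: "mu_bar (sup_mu K) = sup_norm K"
  by (rule mu_bar_eqI) (auto simp: seminorm_c00_sup_norm sup_mu_def)

lemma poly_val_le_sup_mu: "v \<in> Vset \<Longrightarrow> t \<in> K \<Longrightarrow> \<bar>poly_val (real_vec v) t\<bar> \<le> sup_mu K v"
  using poly_val_le_sup_norm by (simp add: sup_mu_def c00_real_vec)

lemma sup_mu_le: "v \<in> Vset \<Longrightarrow> (\<And>t. t \<in> K \<Longrightarrow> \<bar>poly_val (real_vec v) t\<bar> \<le> b) \<Longrightarrow> sup_mu K v \<le> b"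
  using sup_norm_le by (simp add: sup_mu_def c00_real_vec)

lemma sup_mu_witness:
  assumes "v \<in> Vset" "b < sup_mu K v"
  obtains t where "t \<in> K" "b < \<bar>poly_val (real_vec v) t\<bar>"
  using sup_norm_witness[of "real_vec v" b] assms by (auto simp: sup_mu_def c00_real_vec)

text \<open>A polynomial vanishing on an infinite set is zero. A combination of the first n embedded
  monomials is the embedded coefficient vector cut off at n, so the monomials are
  independent.\<close>

lemma sup_mu_in_Bcal:
  assumes "infinite K"
  shows "sup_mu K \<in> Bcal"
proof -
  interpret rational_seminorm "sup_mu K" by (rule rational_seminorm_sup_mu)
  let ?\<mu> = "sup_mu K"
  have norm: "x = (\<lambda>i. 0)" if "x \<in> c00" "mu_bar ?\<mu> x = 0" for x
  proof (rule poly_val_eq_0_on_infinite[OF that(1) assms])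
    fix t assume "t \<in> K"
    then show "poly_val x t = 0"
      using poly_val_le_sup_norm[OF that(1), of t] that(2) by (simp add: mu_bar_sup_mu)
  qed
  have "infinite_dim (Xcar ?\<mu>) (Xzero ?\<mu>) (Xadd ?\<mu>) (Xscale ?\<mu>)"
    unfolding infinite_dim_def
  proof
    fix n
    let ?x = "\<lambda>i. Xembed ?\<mu> (unit_vec i)"
    let ?v = "\<lambda>c n j. if j < n then c j else (0::real)"
    have v: "?v c n \<in> c00" for c n by (rule c00_supported[of "{..<n}"]) auto
    have comb: "lincomb (Xzero ?\<mu>) (Xadd ?\<mu>) (Xscale ?\<mu>) c ?x n = Xembed ?\<mu> (?v c n)" for c n
    proof (induction n)
      case 0
      then show ?case by (simp add: Xzero_def Xembed_def)
    next
      case (Suc n)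
      have "(\<lambda>j. ?v c n j + c n * unit_vec n j) = ?v c (Suc n)"
        by (auto simp: unit_vec_def fun_eq_iff less_Suc_eq)
      then show ?case
        using Suc v[of n c]
        by (simp add: Xscale_Xembed Xadd_Xembed c00_unit_vec c00_scale)
    qed
    show "\<exists>x. (\<forall>i<n. x i \<in> Xcar ?\<mu>) \<and>
        (\<forall>c. lincomb (Xzero ?\<mu>) (Xadd ?\<mu>) (Xscale ?\<mu>) c x n = Xzero ?\<mu> \<longrightarrow> (\<forall>i<n. c i = 0))"
    proof (intro exI[of _ ?x] conjI allI impI)
      fix c i assume "lincomb (Xzero ?\<mu>) (Xadd ?\<mu>) (Xscale ?\<mu>) c ?x n = Xzero ?\<mu>" and i: "i < n"
      then have "?v c n = (\<lambda>i. 0)"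
        unfolding comb using Xembed_eq_Xzero[OF v] norm[OF v] by blast
      with i show "c i = 0" by (auto dest: fun_cong[of _ _ i])
    qed (simp add: Xembed_closed c00_unit_vec)
  qed
  then show ?thesis using norm sup_mu_in_Pcal by (simp add: Bcal_def Pinf_def)
qed

end

text \<open>Stone-Weierstrass costs e/2, and making the coefficients rational costs another e/2 in
  the sup norm over [0,1].\<close>

lemma rational_polynomial_dense:
  assumes "continuous_on {0..1} u" "0 < e"
  obtains v where "v \<in> Vset" "\<And>t. t \<in> {0..1} \<Longrightarrow> \<bar>poly_val (real_vec v) t - u t\<bar> < e"
proof -
  interpret sup_norm_space "{0..1}" by standard auto
  obtain q where q: "real_polynomial_function q" "\<And>t. t \<in> {0..1} \<Longrightarrow> \<bar>u t - q t\<bar> < e / 2"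
    using Stone_Weierstrass_real_polynomial_function[OF compact_Icc assms(1), of "e / 2"] assms(2)
    by auto
  obtain a n where a: "q = (\<lambda>t. \<Sum>i\<le>n. a i * t ^ i)"
    using q(1) real_polynomial_function_iff_sum by metis
  define x where "x i = (if i \<le> n then a i else 0)" for i
  have x: "x \<in> c00" by (rule c00_supported[of "{..n}"]) (auto simp: x_def)
  have px: "poly_val x t = q t" for t
    unfolding a by (subst poly_val_eq[of "{..n}"]) (auto simp: x_def)
  obtain v where v: "v \<in> Vset" "sup_norm {0..1} (\<lambda>i. x i - real_vec v i) < e / 2"
    using seminorm_c00_rat_dense[OF seminorm_c00_sup_norm x, of "e / 2"] assms(2) by auto
  have "\<bar>poly_val (real_vec v) t - u t\<bar> < e" if t: "t \<in> {0..1}" for t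
  proof -
    have "\<bar>poly_val (\<lambda>i. x i - real_vec v i) t\<bar> < e / 2"
      using poly_val_le_sup_norm[OF c00_diff[OF x c00_real_vec[OF v(1)]] t] v(2) by linarith
    then have "\<bar>q t - poly_val (real_vec v) t\<bar> < e / 2"
      using x v(1) by (simp add: poly_val_diff c00_real_vec px)
    then show ?thesis using q(2)[OF t] by linarith
  qed
  then show ?thesis using that v(1) by blast
qed

text \<open>The tent function of height 1; the radius comes first, then the centre.\<close>

definition bump :: "real \<Rightarrow> real \<Rightarrow> real \<Rightarrow> real" where
  "bump r a t = max 0 (1 - \<bar>t - a\<bar> / r)"

lemma bump_range: "0 < r \<Longrightarrow> 0 \<le> bump r a t \<and> bump r a t \<le> 1"
  by (simp add: bump_def)

lemma bump_self: "bump r a a = 1"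
  by (simp add: bump_def)

lemma bump_eq_0: "0 < r \<Longrightarrow> r \<le> \<bar>t - a\<bar> \<Longrightarrow> bump r a t = 0"
  by (simp add: bump_def field_simps)

lemma continuous_bump: "continuous_on A (bump r a)"
  unfolding bump_def divide_inverse by (intro continuous_intros)

lemma finite_real_separated:
  fixes T :: "real set"
  assumes "finite T"
  obtains r where "0 < r" "\<And>s t. s \<in> T \<Longrightarrow> t \<in> T \<Longrightarrow> s \<noteq> t \<Longrightarrow> r \<le> \<bar>s - t\<bar>"
proof -
  \<comment> \<open>The inserted 1 keeps the minimum meaningful when T has at most one
    point.\<close>
  let ?D = "insert 1 ((\<lambda>(s, t). \<bar>s - t\<bar>) ` {(s, t) \<in> T \<times> T. s \<noteq> t})"
  have "finite {(s, t) \<in> T \<times> T. s \<noteq> t}"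
    by (rule finite_subset[of _ "T \<times> T"]) (use assms in auto)
  then have fin: "finite ?D" by simp
  show ?thesis
  proof
    show "0 < Min ?D" using fin by (subst Min_gr_iff) auto
    show "Min ?D \<le> \<bar>s - t\<bar>" if "s \<in> T" "t \<in> T" "s \<noteq> t" for s t
      using that by (intro Min_le fin) force
  qed
qed

text \<open>Centres at least 2r apart leave at most one tent of radius r nonzero at any
  point.\<close>

lemma sum_bump_le_1:
  assumes T: "finite T" and r: "0 < r" "\<And>s t. s \<in> T \<Longrightarrow> t \<in> T \<Longrightarrow> s \<noteq> t \<Longrightarrow> 2 * r \<le> \<bar>s - t\<bar>"
  shows "(\<Sum>s\<in>T. bump r s t) \<le> 1"
proof (cases "\<exists>s\<in>T. bump r s t \<noteq> 0")
  case True
  then obtain a where a: "a \<in> T" "bump r a t \<noteq> 0" by blast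
  then have "\<bar>t - a\<bar> < r" using bump_eq_0[OF r(1), of t a] by linarith
  have "bump r s t = 0" if "s \<in> T - {a}" for s
    using r(2)[of s a] that a \<open>\<bar>t - a\<bar> < r\<close> by (intro bump_eq_0 r) auto
  then have "(\<Sum>s\<in>T. bump r s t) = bump r a t"
    using sum.remove[OF T a(1), of "\<lambda>s. bump r s t"] by simp
  then show ?thesis using bump_range[OF r(1)] by simp
next
  case False
  then show ?thesis by simp
qed

section \<open>Perfect and non-perfect sets K\<close>

context sup_norm_space
begin

text \<open>Each y_s approximates p (1 - 2 bump_s), which flips the sign of p at s without
  increasing its modulus. The sum of n + 1 differences x - y_s is 2 p times a sum of disjoint tents,
  up to approximation errors, so its norm does not grow with n while the total weight does.\<close>

lemma diametral_at_if_perfect: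
  assumes perfect: "\<And>k. k \<in> K \<Longrightarrow> k islimpt K" and x: "x \<in> Vset" and e: "0 < e"
  shows "diametral_at (sup_mu K) x e"
proof -
  define M where "M = sup_mu K x"
  define p where "p = poly_val (real_vec x)"
  have pM: "\<bar>p t\<bar> \<le> M" if "t \<in> K" for t
    unfolding p_def M_def by (rule poly_val_le_sup_mu[OF x that])
  obtain k where k: "k \<in> K" "M - e / 8 < \<bar>p k\<bar>"
    using sup_mu_witness[OF x, of "M - e / 8"] e by (auto simp: M_def p_def)
  have "\<forall>\<^sub>F t in nhds k. M - e / 8 < \<bar>p t\<bar>"
  proof (rule order_tendstoD(1)[OF _ k(2)])
    have "isCont p k"
      using continuous_poly_val[of UNIV] by (simp add: p_def continuous_on_eq_continuous_at)
    then show "((\<lambda>t. \<bar>p t\<bar>) \<longlongrightarrow> \<bar>p k\<bar>) (nhds k)"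
      by (intro tendsto_rabs) (simp add: isCont_def tendsto_at_iff_tendsto_nhds)
  qed
  then obtain \<delta> where \<delta>: "0 < \<delta>" "\<And>t. dist t k < \<delta> \<Longrightarrow> M - e / 8 < \<bar>p t\<bar>"
    by (auto simp: eventually_nhds_metric)
  \<comment> \<open>With N = n + 1, approximation costs N e/8 and the tents cost 2M < N e/2,
    together less than N e.\<close>
  obtain n where n: "4 * M / e < real n" using reals_Archimedean2 by blast
  have "infinite (K \<inter> ball k \<delta>)"
    using perfect[OF k(1)] \<delta>(1) by (simp add: islimpt_eq_infinite_ball)
  then obtain T where T: "finite T" "card T = Suc n" "T \<subseteq> K \<inter> ball k \<delta>"
    using infinite_arbitrarily_large by metis
  obtain r0 where r0: "0 < r0" "\<And>s t. s \<in> T \<Longrightarrow> t \<in> T \<Longrightarrow> s \<noteq> t \<Longrightarrow> r0 \<le> \<bar>s - t\<bar>"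
    using finite_real_separated[OF T(1)] by blast
  \<comment> \<open>Half the separation makes the tents disjoint.\<close>
  define r where "r = r0 / 2"
  have r: "0 < r" using r0 by (simp add: r_def)
  define u where "u s t = p t * (1 - 2 * bump r s t)" for s t
  have "\<exists>v. v \<in> Vset \<and> (\<forall>t\<in>{0..1}. \<bar>poly_val (real_vec v) t - u s t\<bar> < e / 8)" for s
  proof -
    have "continuous_on {0..1} (u s)"
      unfolding u_def p_def by (intro continuous_intros continuous_poly_val continuous_bump)
    then obtain v where "v \<in> Vset" "\<And>t. t \<in> {0..1} \<Longrightarrow> \<bar>poly_val (real_vec v) t - u s t\<bar> < e / 8"
      using rational_polynomial_dense e by (metis divide_pos_pos zero_less_numeral)
    then show ?thesis by blast
  qed
  then obtain y where yV: "\<And>s. y s \<in> Vset"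
    and y: "\<And>s t. t \<in> {0..1} \<Longrightarrow> \<bar>poly_val (real_vec (y s)) t - u s t\<bar> < e / 8"
    by metis
  have yK: "\<bar>poly_val (real_vec (y s)) t - u s t\<bar> < e / 8" if "t \<in> K" for s t
    using y that K_subset by blast
  have "y s \<in> diametral_set (sup_mu K) x e" if s: "s \<in> T" for s
  proof -
    have "sup_mu K (y s) \<le> M + e / 8"
    proof (rule sup_mu_le[OF yV])
      fix t assume t: "t \<in> K"
      have "\<bar>u s t\<bar> \<le> \<bar>p t\<bar>"
        unfolding u_def abs_mult using bump_range[OF r, of s t]
        by (intro mult_left_le) auto
      then show "\<bar>poly_val (real_vec (y s)) t\<bar> \<le> M + e / 8"
        using yK[OF t, of s] pM[OF t] by linarith
    qed
    moreover have "2 * M - e < sup_mu K (\<lambda>i. x i - y s i)"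
    proof -
      have sK: "s \<in> K" and "M - e / 8 < \<bar>p s\<bar>"
        using s T(3) \<delta>(2)[of s] by (auto simp: dist_commute)
      moreover have "u s s = - p s" by (simp add: u_def bump_self)
      moreover have "\<bar>p s - poly_val (real_vec (y s)) s\<bar> \<le> sup_mu K (\<lambda>i. x i - y s i)"
        using poly_val_le_sup_mu[OF Vset_diff[OF x yV] sK, of s]
        by (simp add: real_vec_diff poly_val_diff c00_real_vec x yV p_def)
      ultimately show ?thesis using yK[OF sK, of s] e by linarith
    qed
    ultimately show ?thesis using yV e by (simp add: diametral_set_def M_def)
  qed
  moreover
  define L where "L = map (\<lambda>s. (1::rat, y s)) (sorted_list_of_set T)"
  have setL: "set L = (\<lambda>s. (1, y s)) ` T" using T(1) by (simp add: L_def)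
  have weightL: "weight L = rat_of_nat (Suc n)"
    using T by (simp add: weight_def L_def comp_def sum_list_triv)
  have LV: "\<And>p. p \<in> set L \<Longrightarrow> snd p \<in> Vset" using yV by (auto simp: setL)
  have "sup_mu K (diff_comb x L) \<le> real (Suc n) * (e / 8) + 2 * M"
  proof (rule sup_mu_le[OF Vset_diff_comb[OF x LV]])
    fix t assume t: "t \<in> K"
    have "poly_val (real_vec (diff_comb x L)) t = (\<Sum>s\<in>T. p t - poly_val (real_vec (y s)) t)"
      using linear_V_diff_comb[OF linear_V_poly_val x LV, of L t]
      by (simp add: L_def comp_def p_def sum_list_distinct_conv_sum_set T(1))
    also have "\<dots> = (\<Sum>s\<in>T. u s t - poly_val (real_vec (y s)) t) + 2 * p t * (\<Sum>s\<in>T. bump r s t)"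
      by (simp add: u_def sum_distrib_left algebra_simps flip: sum.distrib)
    finally have eq: "poly_val (real_vec (diff_comb x L)) t = \<dots>" .
    have "\<bar>\<Sum>s\<in>T. u s t - poly_val (real_vec (y s)) t\<bar> \<le> (\<Sum>s\<in>T. e / 8)"
      using yK[OF t] by (intro order_trans[OF sum_abs sum_mono]) (simp add: abs_minus_commute less_imp_le)
    moreover have "\<bar>2 * p t * (\<Sum>s\<in>T. bump r s t)\<bar> \<le> 2 * M"
    proof -
      have "(\<Sum>s\<in>T. bump r s t) \<le> 1"
        using r0(2) by (intro sum_bump_le_1 T r) (simp add: r_def)
      moreover have "0 \<le> (\<Sum>s\<in>T. bump r s t)" using bump_range[OF r] by (intro sum_nonneg) auto
      ultimately have "\<bar>p t\<bar> * \<bar>\<Sum>s\<in>T. bump r s t\<bar> \<le> M * 1"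
        using pM[OF t] by (intro mult_mono) auto
      then show ?thesis by (simp add: abs_mult)
    qed
    ultimately show "\<bar>poly_val (real_vec (diff_comb x L)) t\<bar> \<le> real (Suc n) * (e / 8) + 2 * M"
      unfolding eq by (simp add: T(2) del: of_nat_Suc)
  qed
  moreover have "real (Suc n) * (e / 8) + 2 * M < e * real (Suc n)"
  proof -
    define N where "N = real (Suc n)"
    have "4 * M / e < N" "0 < N" using n by (simp_all add: N_def)
    then have "4 * M < e * N" "0 < e * N" using e by (simp_all add: field_simps)
    moreover have "N * (e / 8) = e * N / 8" by simp
    ultimately have "N * (e / 8) + 2 * M < e * N" by linarith
    then show ?thesis by (simp only: N_def)
  qed
  ultimately show ?thesis
    unfolding diametral_at_def
    by (intro exI[of _ L]) (auto simp: setL weightL simp del: of_nat_Suc)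
qed

lemma has_DLD2P_if_perfect:
  assumes "\<And>k. k \<in> K \<Longrightarrow> k islimpt K"
  shows "has_DLD2P (sup_mu K)"
  by (rule rational_seminorm.has_DLD2P_if_diametral[OF rational_seminorm_sup_mu])
    (rule diametral_at_if_perfect[OF assms])

text \<open>A tent of radius r at a vanishes on the rest of K; x approximates it within 1/8. Off a,
  x - y has modulus below M + 1/4, too small for a diametral y since M >= 7/8. So the large
  difference occurs at a, and the bound on y forces y(a) below x(a). Evaluation at a then bounds the
  norm of every weighted sum of differences from below.\<close>

lemma not_has_DLD2P_if_isolated:
  assumes a: "a \<in> K" and r: "0 < r" "\<And>k. k \<in> K \<Longrightarrow> k \<noteq> a \<Longrightarrow> r \<le> \<bar>k - a\<bar>"
  shows "\<not> has_DLD2P (sup_mu K)"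
proof
  assume "has_DLD2P (sup_mu K)"
  define M where "M x = sup_mu K x" for x
  obtain x where x: "x \<in> Vset" "\<And>t. t \<in> {0..1} \<Longrightarrow> \<bar>poly_val (real_vec x) t - bump r a t\<bar> < 1 / 8"
    using rational_polynomial_dense[OF continuous_bump, of "1/8" r a] by auto
  define p where "p = poly_val (real_vec x)"
  have p: "\<bar>p t - bump r a t\<bar> < 1 / 8" if "t \<in> K" for t
    using x(2) that K_subset by (auto simp: p_def)
  have pa: "\<bar>p a - 1\<bar> < 1 / 8" using p[OF a] by (simp add: bump_self)
  have pk: "\<bar>p t\<bar> < 1 / 8" if "t \<in> K" "t \<noteq> a" for t
    using p[OF that(1)] bump_eq_0[OF r(1) r(2)[OF that]] by simp
  have "M x \<le> 9 / 8"
    unfolding M_def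
  proof (rule sup_mu_le[OF x(1)])
    fix t assume "t \<in> K"
    then show "\<bar>poly_val (real_vec x) t\<bar> \<le> 9 / 8"
      using p[of t] bump_range[OF r(1), of a t] unfolding p_def by linarith
  qed
  have "7 / 8 \<le> M x"
    using poly_val_le_sup_mu[OF x(1) a] pa unfolding M_def p_def by linarith
  have "diametral_at (sup_mu K) x (1 / 8)"
    by (rule rational_seminorm.diametral_if_has_DLD2P[OF rational_seminorm_sup_mu])
      (use x \<open>has_DLD2P (sup_mu K)\<close> in auto)
  then obtain L where L: "\<And>q. q \<in> set L \<Longrightarrow> 0 \<le> fst q \<and> snd q \<in> diametral_set (sup_mu K) x (1 / 8)"
    "0 < weight L" "M (diff_comb x L) < 1 / 8 * real_of_rat (weight L)"
    by (auto simp: diametral_at_def M_def)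
  have LV: "\<And>q. q \<in> set L \<Longrightarrow> snd q \<in> Vset" using L(1) by (auto simp: diametral_set_def)
  have far: "1 / 8 \<le> p a - poly_val (real_vec (snd q)) a" if q: "q \<in> set L" for q
  proof -
    define y where "y = snd q"
    have y: "y \<in> Vset" "M y < M x + 1 / 8" "2 * M x - 1 / 8 < M (\<lambda>i. x i - y i)"
      using L(1)[OF q] by (auto simp: diametral_set_def M_def y_def)
    obtain t where t: "t \<in> K" "2 * M x - 1 / 8 < \<bar>poly_val (real_vec (\<lambda>i. x i - y i)) t\<bar>"
      using sup_mu_witness[OF Vset_diff[OF x(1) y(1)] y(3)[unfolded M_def]] by (auto simp: M_def)
    have far: "2 * M x - 1 / 8 < \<bar>p t - poly_val (real_vec y) t\<bar>"
      using t(2) by (simp add: real_vec_diff poly_val_diff c00_real_vec x y p_def)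
    have yt: "\<bar>poly_val (real_vec y) t\<bar> < M x + 1 / 8"
      using poly_val_le_sup_mu[OF y(1) t(1)] y(2) by (simp add: M_def)
    have "t = a"
    proof (rule ccontr)
      assume "t \<noteq> a"
      from pk[OF t(1) this] far yt \<open>7 / 8 \<le> M x\<close> show False by linarith
    qed
    with far[unfolded \<open>t = a\<close>] yt[unfolded \<open>t = a\<close>] pa \<open>7 / 8 \<le> M x\<close> \<open>M x \<le> 9 / 8\<close>
    have "1 / 8 \<le> p a - poly_val (real_vec y) a" by linarith
    then show ?thesis by (simp add: y_def)
  qed
  have "1 / 8 * real_of_rat (weight L) = (\<Sum>q\<leftarrow>L. real_of_rat (fst q) * (1 / 8))"
    unfolding real_of_rat_weight sum_list_mult_const by simp
  also have "\<dots> \<le> (\<Sum>q\<leftarrow>L. real_of_rat (fst q) * (p a - poly_val (real_vec (snd q)) a))"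
    using far L(1) by (intro sum_list_mono mult_left_mono) auto
  also have "\<dots> = poly_val (real_vec (diff_comb x L)) a"
    using linear_V_diff_comb[OF linear_V_poly_val x(1) LV, of L a] by (simp add: p_def)
  also have "\<dots> \<le> M (diff_comb x L)"
    using poly_val_le_sup_mu[OF Vset_diff_comb[OF x(1) LV] a, of L] by (simp add: M_def)
  finally show False using L(3) by simp
qed

end

subsection \<open>Reducing a Gdelta set to the DLD2P\<close>

text \<open>The factor 1/2 matters: for \<open>\<phi> n \<le> 1\<close> the interval ends by 3/2 of
  its left endpoint, short of twice that endpoint, where the next larger interval starts.\<close>

definition Kint :: "(nat \<Rightarrow> real) \<Rightarrow> nat \<Rightarrow> real set" where
  "Kint \<phi> n = {(1/2) ^ Suc n .. (1/2) ^ Suc n * (1 + \<phi> n / 2)}"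

definition Kset :: "(nat \<Rightarrow> real) \<Rightarrow> real set" where
  "Kset \<phi> = (\<Union>n. Kint \<phi> n)"

lemma Kint_bound: "\<phi> n \<le> 1 \<Longrightarrow> k \<in> Kint \<phi> n \<Longrightarrow> (1/2) ^ Suc n \<le> k \<and> k \<le> 3/2 * (1/2) ^ Suc n"
proof -
  assume \<phi>: "\<phi> n \<le> 1" and k: "k \<in> Kint \<phi> n"
  have "(1/2) ^ Suc n * (1 + \<phi> n / 2) \<le> (1/2) ^ Suc n * (3/2 :: real)"
    using \<phi> by (intro mult_left_mono) auto
  with k show ?thesis unfolding Kint_def atLeastAtMost_iff by linarith
qed

lemma sup_norm_space_Kset:
  assumes "\<And>n. 0 \<le> \<phi> n" "\<And>n. \<phi> n \<le> 1"
  shows "sup_norm_space (Kset \<phi>)"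
proof
  show "Kset \<phi> \<subseteq> {0..1}"
  proof
    fix k assume "k \<in> Kset \<phi>"
    then obtain n where "k \<in> Kint \<phi> n" by (auto simp: Kset_def)
    from Kint_bound[OF assms(2) this] have "(1/2) ^ Suc n \<le> k" "k \<le> 3/2 * (1/2) ^ Suc n" by auto
    moreover have "(1/2 :: real) ^ n \<le> 1" by (rule power_le_one) auto
    moreover have "0 \<le> (1/2 :: real) ^ n" by simp
    ultimately show "k \<in> {0..1}" by simp
  qed
  show "Kset \<phi> \<noteq> {}"
    using assms(1)[of 0] by (auto simp: Kset_def Kint_def intro!: exI[of _ 0])
qed

lemma infinite_Kset:
  assumes "\<And>n. 0 \<le> \<phi> n"
  shows "infinite (Kset \<phi>)"
proof -
  have "inj (\<lambda>n. (1/2 :: real) ^ Suc n)" by (rule injI) (auto simp: power_inject_exp')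
  then have "infinite (range (\<lambda>n. (1/2 :: real) ^ Suc n))" by (rule range_inj_infinite)
  moreover have "range (\<lambda>n. (1/2 :: real) ^ Suc n) \<subseteq> Kset \<phi>"
    using assms by (auto simp: Kset_def Kint_def)
  ultimately show ?thesis using finite_subset by blast
qed

lemma Kset_perfect:
  assumes "\<And>n. 0 < \<phi> n" "k \<in> Kset \<phi>"
  shows "k islimpt Kset \<phi>"
proof -
  obtain n where n: "k \<in> Kint \<phi> n" using assms(2) by (auto simp: Kset_def)
  have "k islimpt Kint \<phi> n"
    using n assms(1)[of n] unfolding Kint_def by (subst islimpt_Icc) auto
  then show ?thesis by (rule islimpt_subset) (auto simp: Kset_def)
qed

text \<open>With a = 2^-(n+1), intervals below a end by 3/2 times a/2, which is 3a/4, and those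
  above start at 2a or later; hence the quarter.\<close>

lemma Kset_isolated:
  assumes "\<And>n. \<phi> n \<le> 1" "\<phi> n = 0" "k \<in> Kset \<phi>" "k \<noteq> (1/2) ^ Suc n"
  shows "(1/2) ^ Suc n / 4 \<le> \<bar>k - (1/2) ^ Suc n\<bar>"
proof -
  let ?a = "\<lambda>n. (1/2 :: real) ^ Suc n"
  have pos: "0 < ?a n" by simp
  obtain m where m: "k \<in> Kint \<phi> m" using assms(3) by (auto simp: Kset_def)
  note b = Kint_bound[OF assms(1) m]
  consider "m = n" | "Suc n \<le> m" | "Suc m \<le> n" by linarith
  then show ?thesis
  proof cases
    case 1
    then show ?thesis using m assms(2,4) by (auto simp: Kint_def)
  next
    case 2
    then have "?a m \<le> ?a (Suc n)" by (intro power_decreasing) auto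
    then show ?thesis using b pos by simp
  next
    case 3
    then have "?a n \<le> ?a (Suc m)" by (intro power_decreasing) auto
    then show ?thesis using b pos by simp
  qed
qed

text \<open>Every point of one set lies within d of a point of the other, and a polynomial is
  Lipschitz on [0,1]. The inequality is used in both directions to get continuity.\<close>

lemma sup_norm_Kset_le:
  assumes \<phi>: "\<And>n. 0 \<le> \<phi> n" "\<And>n. \<phi> n \<le> 1" and \<psi>: "\<And>n. 0 \<le> \<psi> n" "\<And>n. \<psi> n \<le> 1"
    and d: "\<And>n. \<bar>\<phi> n - \<psi> n\<bar> \<le> d" and x: "x \<in> c00"
  shows "sup_norm (Kset \<phi>) x \<le> sup_norm (Kset \<psi>) x + (\<Sum>i | x i \<noteq> 0. \<bar>x i\<bar> * real i) * d"
proof -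
  interpret A: sup_norm_space "Kset \<phi>" by (rule sup_norm_space_Kset[OF \<phi>])
  interpret B: sup_norm_space "Kset \<psi>" by (rule sup_norm_space_Kset[OF \<psi>])
  let ?L = "\<Sum>i | x i \<noteq> 0. \<bar>x i\<bar> * real i"
  show ?thesis
  proof (rule A.sup_norm_le[OF x])
    fix k assume k: "k \<in> Kset \<phi>"
    then obtain n where n: "k \<in> Kint \<phi> n" by (auto simp: Kset_def)
    define a :: real where "a = (1/2) ^ Suc n"
    have a: "0 < a" "a \<le> 1" unfolding a_def by (auto intro: power_le_one simp del: power_Suc)
    \<comment> \<open>The n-th intervals share their left endpoint, so clamping at the right end
      alone moves k into the other interval.\<close>
    define l where "l = min k (a * (1 + \<psi> n / 2))"
    have ka: "a \<le> k" "k \<le> a * (1 + \<phi> n / 2)" using n by (auto simp: Kint_def a_def)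
    have "a \<le> a * (1 + \<psi> n / 2)" using a \<psi>(1)[of n] by simp
    then have "l \<in> Kint \<psi> n" using ka by (auto simp: Kint_def l_def simp flip: a_def simp del: power_Suc)
    then have l: "l \<in> Kset \<psi>" by (auto simp: Kset_def)
    have "a * (1 + \<phi> n / 2) - a * (1 + \<psi> n / 2) \<le> d"
    proof -
      have "a * (1 + \<phi> n / 2) - a * (1 + \<psi> n / 2) = a * ((\<phi> n - \<psi> n) / 2)"
        by (simp add: algebra_simps)
      also have "\<dots> \<le> a * d" using a d[of n] by (intro mult_left_mono) auto
      also have "\<dots> \<le> d" using a d[of n] by (intro mult_left_le_one_le) auto
      finally show ?thesis .
    qed
    moreover have "0 \<le> d" using d[of n] by linarith
    ultimately have kl: "\<bar>k - l\<bar> \<le> d" using ka by (auto simp: l_def min_def)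
    have "\<bar>poly_val x k - poly_val x l\<bar> \<le> ?L * \<bar>k - l\<bar>"
      using k l A.K_subset B.K_subset by (intro poly_val_Lipschitz) auto
    also have "\<dots> \<le> ?L * d" by (intro mult_left_mono kl sum_nonneg) auto
    finally show "\<bar>poly_val x k\<bar> \<le> sup_norm (Kset \<psi>) x + ?L * d"
      using B.poly_val_le_sup_norm[OF x l] by linarith
  qed
qed

section \<open>Truncated distance to the complement of an open set\<close>

context Metric_space
begin

text \<open>The inserted 1 caps the distance and keeps the infimum over a nonempty set when U covers
  the space.\<close>

definition gap :: "'a set \<Rightarrow> 'a \<Rightarrow> real" where
  "gap U y = Inf (insert 1 (d y ` (M - U)))"

lemma gap_bdd: "bdd_below (insert 1 (d y ` (M - U)))"
  by (rule bdd_belowI[of _ 0]) auto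

lemma gap_le_1: "gap U y \<le> 1"
  unfolding gap_def by (rule cInf_lower[OF _ gap_bdd]) simp

lemma gap_nonneg: "0 \<le> gap U y"
  unfolding gap_def by (rule cInf_greatest) auto

lemma gap_pos_iff:
  assumes "openin mtopology U" "y \<in> M"
  shows "0 < gap U y \<longleftrightarrow> y \<in> U"
proof
  assume "0 < gap U y"
  show "y \<in> U"
  proof (rule ccontr)
    assume "y \<notin> U"
    then have "gap U y \<le> d y y"
      unfolding gap_def using assms by (intro cInf_lower gap_bdd insertI2 imageI) auto
    with \<open>0 < gap U y\<close> assms show False by simp
  qed
next
  assume "y \<in> U"
  then obtain r where r: "0 < r" "mball y r \<subseteq> U"
    using assms openin_mtopology by blast
  have "min 1 r \<le> gap U y"
    unfolding gap_def
  proof (rule cInf_greatest)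
    fix s assume "s \<in> insert 1 (d y ` (M - U))"
    then show "min 1 r \<le> s" using r(2) assms(2) by (force simp: mball_def not_less)
  qed simp
  with r(1) show "0 < gap U y" by linarith
qed

lemma gap_le:
  assumes "y \<in> M" "z \<in> M"
  shows "gap U y \<le> gap U z + d y z"
proof -
  have "gap U y - d y z \<le> gap U z"
    unfolding gap_def[of U z]
  proof (rule cInf_greatest)
    fix s assume "s \<in> insert 1 (d z ` (M - U))"
    then consider "s = 1" | w where "w \<in> M - U" "s = d z w" by blast
    then show "gap U y - d y z \<le> s"
    proof cases
      case 1
      then show ?thesis using gap_le_1[of U y] nonneg[of y z] by linarith
    next
      case 2
      then have "gap U y \<le> d y w" unfolding gap_def by (intro cInf_lower gap_bdd) auto
      with 2 triangle[of y z w] assms show ?thesis by auto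
    qed
  qed simp
  then show ?thesis by simp
qed

lemma gap_Lipschitz: "y \<in> M \<Longrightarrow> z \<in> M \<Longrightarrow> \<bar>gap U y - gap U z\<bar> \<le> d y z"
  using gap_le[of y z U] gap_le[of z y U] commute[of y z] by linarith

end

lemma DLD2P_reduction:
  assumes "metrizable_space Y" "gdelta_in Y B"
  obtains f where "continuous_map Y RV f" "f \<in> topspace Y \<rightarrow> Bcal"
    "{y \<in> topspace Y. has_DLD2P (f y)} = B"
proof -
  obtain M d where MD: "Metric_space M d" and Y: "Y = Metric_space.mtopology M d"
    using assms(1) by (auto simp: metrizable_space_def)
  interpret Metric_space M d by (rule MD)
  obtain U where "(\<forall>n. openin Y (U n)) \<and> (\<forall>n. U (Suc n) \<subseteq> U n) \<and> \<Inter>(range U) = B"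
    using assms(2) unfolding gdelta_in_descending by (elim exE)
  then have U: "\<And>n. openin mtopology (U n)" "\<Inter>(range U) = B" by (simp_all add: Y)
  define \<phi> where "\<phi> y n = gap (U n) y" for y and n :: nat
  have \<phi>: "\<And>y n. 0 \<le> \<phi> y n" "\<And>y n. \<phi> y n \<le> 1" by (auto simp: \<phi>_def gap_nonneg gap_le_1)
  define f where "f y = sup_mu (Kset (\<phi> y))" for y
  note sp = sup_norm_space_Kset[OF \<phi>]
  have cont: "continuous_map mtopology euclideanreal (\<lambda>y. f y v)" if v: "v \<in> Vset" for v
  proof -
    let ?x = "real_vec v"
    \<comment> \<open>The added 1 makes the Lipschitz constant positive, so that it can divide
      \<open>\<epsilon>\<close>.\<close>
    define C where "C = (\<Sum>i | ?x i \<noteq> 0. \<bar>?x i\<bar> * real i) + 1"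
    have C: "0 < C" unfolding C_def by (intro add_nonneg_pos sum_nonneg) auto
    have le: "f y v \<le> f z v + C * d y z" if "y \<in> M" "z \<in> M" for y z
    proof -
      have "f y v \<le> f z v + (C - 1) * d y z"
        using sup_norm_Kset_le[of "\<phi> y" "\<phi> z" "d y z" ?x] \<phi> gap_Lipschitz[OF that] v
        by (simp add: f_def sup_mu_def \<phi>_def C_def c00_real_vec)
      then show ?thesis unfolding left_diff_distrib using nonneg[of y z] by linarith
    qed
    have lip: "\<bar>f y v - f z v\<bar> \<le> C * d y z" if "y \<in> M" "z \<in> M" for y z
      using le[OF that] le[OF that(2,1)] commute[of y z] by (simp add: abs_le_iff)
    have "\<exists>\<delta>>0. \<forall>z. z \<in> M \<and> d y z < \<delta> \<longrightarrow> dist (f y v) (f z v) < \<epsilon>" if "y \<in> M" "0 < \<epsilon>" for y \<epsilon>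
    proof (intro exI[of _ "\<epsilon> / C"] conjI allI impI)
      fix z assume "z \<in> M \<and> d y z < \<epsilon> / C"
      then show "dist (f y v) (f z v) < \<epsilon>"
        using lip[OF \<open>y \<in> M\<close>, of z] C by (simp add: dist_real_def field_simps)
    qed (use that C in simp)
    then show ?thesis
      using metric_continuous_map[OF Met_TC.Metric_space_axioms, of "\<lambda>y. f y v"]
      by (simp add: mtopology_is_euclidean)
  qed
  show ?thesis
  proof
    show "continuous_map Y RV f"
      unfolding RV_def Y continuous_map_componentwise
      using cont by (auto simp: f_def sup_mu_def)
    show "f \<in> topspace Y \<rightarrow> Bcal"
      using sup_norm_space.sup_mu_in_Bcal[OF sp infinite_Kset[OF \<phi>(1)]] by (auto simp: f_def)
    have "has_DLD2P (f y) \<longleftrightarrow> y \<in> B" if y: "y \<in> M" for y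
    proof
      assume D: "has_DLD2P (f y)"
      have "0 < \<phi> y n" for n
      proof (rule ccontr)
        assume "\<not> 0 < \<phi> y n"
        then have "\<phi> y n = 0" using \<phi>(1)[of y n] by simp
        moreover from this have "(1/2) ^ Suc n \<in> Kset (\<phi> y)"
          by (auto simp: Kset_def Kint_def intro!: exI[of _ n])
        ultimately have "\<not> has_DLD2P (f y)"
          unfolding f_def using Kset_isolated[of "\<phi> y" n] \<phi>(2)
          by (intro sup_norm_space.not_has_DLD2P_if_isolated[OF sp, where a = "(1/2) ^ Suc n" and r = "(1/2) ^ Suc n / 4"]) auto
        with D show False by simp
      qed
      then show "y \<in> B" using gap_pos_iff[OF U(1) y] U(2) by (auto simp: \<phi>_def)
    next
      assume "y \<in> B"
      then have "0 < \<phi> y n" for n using gap_pos_iff[OF U(1) y] U(2) by (auto simp: \<phi>_def)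
      then show "has_DLD2P (f y)"
        unfolding f_def
        by (intro sup_norm_space.has_DLD2P_if_perfect[OF sp] Kset_perfect)
    qed
    moreover have "B \<subseteq> M"
      using gdelta_in_subset[OF assms(2)] by (simp add: Y)
    ultimately show "{y \<in> topspace Y. has_DLD2P (f y)} = B" by (auto simp: Y)
  qed
qed

theorem theorem5p11:
  assumes "\<I> \<in> {Pcal, Pinf, Bcal}"
  shows "Gdelta_complete TYPE('y) (subtopology RV \<I>) {\<mu> \<in> \<I>. has_DLD2P \<mu>}"
proof -
  have sub: "Bcal \<subseteq> \<I>" "\<I> \<subseteq> Pcal" "\<I> \<subseteq> topspace RV"
    using assms by (auto simp: Bcal_def Pinf_def Pcal_def)
  have "\<exists>f. continuous_map Y (subtopology RV \<I>) f \<and> {y \<in> topspace Y. f y \<in> {\<mu> \<in> \<I>. has_DLD2P \<mu>}} = B"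
    if Y: "Polish_space Y" and B: "gdelta_in Y B" for Y :: "'y topology" and B
  proof -
    have "metrizable_space Y"
      using Y completely_metrizable_imp_metrizable_space by (auto simp: Polish_space_def)
    then obtain f where f: "continuous_map Y RV f" "f \<in> topspace Y \<rightarrow> Bcal"
      "{y \<in> topspace Y. has_DLD2P (f y)} = B"
      using DLD2P_reduction[OF _ B] by blast
    \<comment> \<open>The values lie in \<open>Bcal\<close>, which is contained in each of the three
      classes, so continuity into \<open>RV\<close> is continuity into the subspace.\<close>
    then show ?thesis
      using sub(1) by (intro exI[of _ f]) (auto simp: continuous_map_in_subtopology)
  qed
  then show ?thesis
    unfolding Gdelta_complete_def using sub gdelta_in_DLD2P[OF sub(2)] by auto
qed

end
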